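(* For the following unweighted $d$-regular periodic lattices, the edge Laplacian $\widetilde\Delta_1=\Delta_1=d^1\delta^1$ on $\ell^2$ $1$-cochains has the following exact operator norms: - square lattice $\mathbb Z^2$ ($d=4$): $\|\widetilde\Delta_1\|=8=2d$; - triangular lattice ($d=6$): $\|\widetilde\Delta_1\|=9<12=2d$; - cubic lattice $\mathbb Z^3$ ($d=6$): $\|\widetilde\Delta_1\|=12=2d$; - body-centered cubic lattice ($d=8$): $\|\widetilde\Delta_1\|=16=2d$; - face-centered cubic lattice ($d=12$): $\|\widetilde\Delta_1\|=16<24=2d$; - Kagome lattice ($d=4$): $\|\widetilde\Delta_1\|=6<8=2d$; - diamond lattice ($d=4$): $\|\widetilde\Delta_1\|=8=2d$; - hypercubic lattice $\mathbb Z^4$ ($d=8$): $\|\widetilde\Delta_1\|=16=2d$.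
   Context: Each lattice is an unweighted graph viewed as a $1$-dimensional complex (truncated at dimension $1$ even if it contains triangles). A $1$-cochain is a function $f$ on oriented edges with $f([y,x])=-f([x,y])$, with norm $\|f\|^2=\sum_{\{x,y\}\in\mathcal E}|f([x,y])|^2$. $(d^1u)([x,y])=u(y)-u(x)$ and $(\delta^1f)(x)=\sum_{y\sim x}f([y,x])$. Lattices: $\mathbb Z^r$ with nearest-neighbor adjacency ($x\sim x\pm e_j$). Triangular: vertex set $\mathbb Z^2$, with $x\sim x\pm e_1,\ x\pm e_2,\ x\pm(e_1+e_2)$. Body-centered cubic: vertex set $\mathbb Z^3\cup(\mathbb Z^3+(\tfrac12,\tfrac12,\tfrac12))$, two vertices adjacent iff at Euclidean distance $\sqrt3/2$. Face-centered cubic: vertex set consisting of $\mathbb Z^3$ and the centers of all faces of unit cubes (translates by $\mathbb Z^3$ of $(0,\tfrac12,\tfrac12),(\tfrac12,0,\tfrac12),(\tfrac12,\tfrac12,0)$), two vertices adjacent iff at distance $1/\sqrt2$. Kagome (planar lattice of corner-sharing triangles): vertices $A(x),B(x),C(x)$, $x\in\mathbb Z^2$, with edges $A(x)\sim B(x),B(x-e_1)$; $A(x)\sim C(x),C(x-e_2)$; $B(x)\sim C(x),C(x-e_2+e_1)$. Diamond: vertices $A(x),B(x)$, $x\in\mathbb Z^3$, with $A(x)\sim B(x),B(x-e_1),B(x-e_2),B(x-e_3)$. *)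

theory Defs
  imports "HOL-Analysis.Analysis"
begin

record 'v graph =
  vertices :: "'v set"
  adjacent :: "'v \<Rightarrow> 'v \<Rightarrow> bool"

definition oriented_edges :: "'v graph \<Rightarrow> ('v \<times> 'v) set" where
  "oriented_edges G = {(x, y). x \<in> vertices G \<and> y \<in> vertices G \<and> adjacent G x y}"

definition edges :: "'v graph \<Rightarrow> 'v set set" where
  "edges G = {{x, y} | x y. (x, y) \<in> oriented_edges G}"

definition nbrs :: "'v graph \<Rightarrow> 'v \<Rightarrow> 'v set" where
  "nbrs G x = {y. (x, y) \<in> oriented_edges G}"

definition regular_graph :: "'v graph \<Rightarrow> nat \<Rightarrow> bool" where
  "regular_graph G d \<longleftrightarrow>
     sym (oriented_edges G) \<and> irrefl (oriented_edges G) \<and>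
     (\<forall>x\<in>vertices G. finite (nbrs G x) \<and> card (nbrs G x) = d)"

text \<open>The value of a 1-cochain on the oriented edge \<open>[x, y]\<close> is \<open>f (x, y)\<close>. Since HOL functions are
  total, cochains are required to vanish off the oriented edges, so that two cochains are equal
  iff they agree on all oriented edges.\<close>

definition cochains1 :: "'v graph \<Rightarrow> ('v \<times> 'v \<Rightarrow> complex) set" where
  "cochains1 G =
     {f. (\<forall>(x, y)\<in>oriented_edges G. f (y, x) = - f (x, y)) \<and>
         (\<forall>e. e \<notin> oriented_edges G \<longrightarrow> f e = 0)}"

text \<open>An arbitrary orientation of an unoriented edge; \<open>|f|\<close> does not depend on it.\<close>

definition orient :: "'v set \<Rightarrow> 'v \<times> 'v" where
  "orient e = (SOME p. e = {fst p, snd p})"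

lemma cmod_orient:
  assumes "f \<in> cochains1 G" "(x, y) \<in> oriented_edges G"
  shows "cmod (f (orient {x, y})) = cmod (f (x, y))"
proof -
  have "{x, y} = {fst (orient {x, y}), snd (orient {x, y})}"
    unfolding orient_def by (rule someI [of _ "(x, y)"]) simp
  then have "orient {x, y} = (x, y) \<or> orient {x, y} = (y, x)"
    by (cases "orient {x, y}") (auto simp: doubleton_eq_iff)
  moreover have "f (y, x) = - f (x, y)"
    using assms unfolding cochains1_def by blast
  ultimately show ?thesis by auto
qed

definition l2_cochains1 :: "'v graph \<Rightarrow> ('v \<times> 'v \<Rightarrow> complex) set" where
  "l2_cochains1 G =
     {f \<in> cochains1 G. (\<lambda>e. (cmod (f (orient e)))\<^sup>2) summable_on edges G}"

definition cochain_norm :: "'v graph \<Rightarrow> ('v \<times> 'v \<Rightarrow> complex) \<Rightarrow> real" where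
  "cochain_norm G f = sqrt (\<Sum>\<^sub>\<infinity>e\<in>edges G. (cmod (f (orient e)))\<^sup>2)"

definition coboundary1 :: "'v graph \<Rightarrow> ('v \<Rightarrow> complex) \<Rightarrow> ('v \<times> 'v \<Rightarrow> complex)" where
  "coboundary1 G u = (\<lambda>(x, y). if (x, y) \<in> oriented_edges G then u y - u x else 0)"

definition boundary1 :: "'v graph \<Rightarrow> ('v \<times> 'v \<Rightarrow> complex) \<Rightarrow> ('v \<Rightarrow> complex)" where
  "boundary1 G f = (\<lambda>x. \<Sum>y\<in>nbrs G x. f (y, x))"

definition edge_laplacian :: "'v graph \<Rightarrow> ('v \<times> 'v \<Rightarrow> complex) \<Rightarrow> ('v \<times> 'v \<Rightarrow> complex)" where
  "edge_laplacian G f = coboundary1 G (boundary1 G f)"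

definition l2_bounded ::
    "'v graph \<Rightarrow> (('v \<times> 'v \<Rightarrow> complex) \<Rightarrow> ('v \<times> 'v \<Rightarrow> complex)) \<Rightarrow> bool" where
  "l2_bounded G T \<longleftrightarrow>
     (\<forall>f\<in>l2_cochains1 G. T f \<in> l2_cochains1 G) \<and>
     (\<exists>C. \<forall>f\<in>l2_cochains1 G. cochain_norm G (T f) \<le> C * cochain_norm G f)"

text \<open>The supremum is taken in the reals, so it is the operator norm only for operators
  satisfying \<open>l2_bounded\<close>.\<close>

definition l2_onorm ::
    "'v graph \<Rightarrow> (('v \<times> 'v \<Rightarrow> complex) \<Rightarrow> ('v \<times> 'v \<Rightarrow> complex)) \<Rightarrow> real" where
  "l2_onorm G T = (SUP f\<in>{f \<in> l2_cochains1 G. cochain_norm G f \<le> 1}. cochain_norm G (T f))"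

definition integer_lattice :: "(int ^ 'n) graph" where
  "integer_lattice = \<lparr>vertices = UNIV,
     adjacent = (\<lambda>x y. \<exists>j. y = x + axis j 1 \<or> y = x - axis j 1)\<rparr>"

definition triangular_lattice :: "(int ^ 2) graph" where
  "triangular_lattice = \<lparr>vertices = UNIV,
     adjacent = (\<lambda>x y. \<exists>v\<in>{axis 1 1, axis 2 1, axis 1 1 + axis 2 1}. y = x + v \<or> y = x - v)\<rparr>"

definition integer_points :: "(real ^ 3) set" where
  "integer_points = {x. \<forall>i. x $ i \<in> \<int>}"

definition bcc_lattice :: "(real ^ 3) graph" where
  "bcc_lattice = \<lparr>
     vertices = integer_points \<union> (\<lambda>z. z + vector [1/2, 1/2, 1/2]) ` integer_points,
     adjacent = (\<lambda>x y. dist x y = sqrt 3 / 2)\<rparr>"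

definition fcc_lattice :: "(real ^ 3) graph" where
  "fcc_lattice = \<lparr>
     vertices = integer_points \<union>
       (\<Union>c\<in>{vector [0, 1/2, 1/2], vector [1/2, 0, 1/2], vector [1/2, 1/2, 0]}.
          (\<lambda>z. z + c) ` integer_points),
     adjacent = (\<lambda>x y. dist x y = 1 / sqrt 2)\<rparr>"

datatype kagome_vertex = KA "int ^ 2" | KB "int ^ 2" | KC "int ^ 2"

inductive kagome_bond :: "kagome_vertex \<Rightarrow> kagome_vertex \<Rightarrow> bool" where
  "kagome_bond (KA x) (KB x)"
| "kagome_bond (KA x) (KB (x - axis 1 1))"
| "kagome_bond (KA x) (KC x)"
| "kagome_bond (KA x) (KC (x - axis 2 1))"
| "kagome_bond (KB x) (KC x)"
| "kagome_bond (KB x) (KC (x - axis 2 1 + axis 1 1))"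

definition kagome_lattice :: "kagome_vertex graph" where
  "kagome_lattice = \<lparr>vertices = UNIV, adjacent = symclp kagome_bond\<rparr>"

datatype diamond_vertex = DA "int ^ 3" | DB "int ^ 3"

inductive diamond_bond :: "diamond_vertex \<Rightarrow> diamond_vertex \<Rightarrow> bool" where
  "diamond_bond (DA x) (DB x)"
| "diamond_bond (DA x) (DB (x - axis j 1))"

definition diamond_lattice :: "diamond_vertex graph" where
  "diamond_lattice = \<lparr>vertices = UNIV, adjacent = symclp diamond_bond\<rparr>"

end

theory Submission
  imports Defs "HOL-Real_Asymp.Real_Asymp"
begin

text \<open>The operator \<open>d \<delta>\<close> has the norm of \<open>\<delta> d\<close>, the vertex Laplacian, and all eight norms have one
  explanation. Suppose that the edges of a graph are partitioned into cliques with \<open>k\<close> vertices and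
  that every vertex lies in \<open>m\<close> of them. Then the graph is \<open>(k - 1) m\<close>-regular, and the norm of the edge
  Laplacian is at most \<open>k m\<close>: the Laplacian of a complete graph on \<open>k\<close> vertices has norm \<open>k\<close>
  (\<open>sum_pair_differences\<close> for \<open>d\<close>, \<open>clique_divergence_bound\<close> for \<open>\<delta>\<close>), and summing over the cliques counts
  each vertex \<open>m\<close> times (\<open>edge_laplacian_bound\<close>).

  The bound is attained when there is a unimodular function \<open>u\<close> on the vertices whose sum over every
  clique is zero. Such a \<open>u\<close> satisfies \<open>\<delta> d u = k m u\<close>, and its
  coboundary is a bounded eigenfunction of the edge Laplacian for \<open>k m\<close>. It is not square summable, but
  on a graph of polynomial growth its truncations suffice: a smaller norm would force exponential growth
  (\<open>l2_onorm_ge\<close>).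

  What remains is to exhibit cliques and \<open>u\<close>. The integer lattices, the body-centered lattice and the
  diamond lattice are bipartite: the cliques are the single edges, \<open>u = \<plusminus>1\<close> is constant on the classes,
  and the norm is \<open>2 d\<close>. In the other lattices the cliques are larger and the norm drops below \<open>2 d\<close>:
  triangles of one orientation in the triangular lattice (\<open>k = m = 3\<close>), all triangles in the Kagome
  lattice (\<open>k = 3\<close>, \<open>m = 2\<close>), and tetrahedra of one orientation in the face-centered lattice
  (\<open>k = m = 4\<close>). On triangles \<open>u\<close> takes the cube roots of unity as values, on tetrahedra two signs of
  each kind.\<close>

section \<open>Sums over fibres and domination\<close>

text \<open>Every rearrangement of infinite sums below is of this kind: oriented edges are grouped by their
  underlying edge or by the clique that contains them, and incidences between vertices and
  cliques are grouped by vertex or by clique. Stating it as an equivalence of \<open>has_sum\<close> carries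
  summability along with the value, in both directions.\<close>

lemma has_sum_fibres:
  fixes h :: "'a \<Rightarrow> real"
  assumes nonneg: "\<And>a. a \<in> A \<Longrightarrow> 0 \<le> h a"
    and maps: "\<And>a. a \<in> A \<Longrightarrow> g a \<in> B"
    and fin: "\<And>b. b \<in> B \<Longrightarrow> finite {a \<in> A. g a = b}"
  shows "(h has_sum s) A \<longleftrightarrow> ((\<lambda>b. \<Sum>a | a \<in> A \<and> g a = b. h a) has_sum s) B"
proof -
  let ?D = "\<lambda>b. {a \<in> A. g a = b}"
  have bij: "bij_betw snd (Sigma B ?D) A"
    unfolding bij_betw_def
  proof
    show "inj_on snd (Sigma B ?D)" by (auto simp: inj_on_def)
    show "snd ` Sigma B ?D = A" using maps by force
  qed
  have reindex: "(h has_sum s) A \<longleftrightarrow> ((\<lambda>p. h (snd p)) has_sum s) (Sigma B ?D)"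
    using has_sum_reindex_bij_betw[OF bij, of h s] by simp
  have fibre: "((\<lambda>a. h (snd (b, a))) has_sum (\<Sum>a\<in>?D b. h a)) (?D b)" if "b \<in> B" for b
    using fin[OF that] by simp
  show ?thesis
    unfolding reindex
  proof
    assume "((\<lambda>p. h (snd p)) has_sum s) (Sigma B ?D)"
    then show "((\<lambda>b. \<Sum>a\<in>?D b. h a) has_sum s) B"
      using fibre by (rule has_sum_Sigma')
  next
    assume base: "((\<lambda>b. \<Sum>a\<in>?D b. h a) has_sum s) B"
    have "(\<lambda>p. h (snd p)) summable_on Sigma B ?D"
      by (rule summable_on_SigmaI[OF fibre]) (use base nonneg in \<open>auto simp: summable_on_def\<close>)
    then show "((\<lambda>p. h (snd p)) has_sum s) (Sigma B ?D)"
      using fibre base by (intro has_sum_SigmaI)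
  qed
qed

lemma has_sum_dominated:
  fixes f g :: "'a \<Rightarrow> real"
  assumes g: "(g has_sum b) A" and nonneg: "\<And>x. x \<in> A \<Longrightarrow> 0 \<le> f x"
    and le: "\<And>x. x \<in> A \<Longrightarrow> f x \<le> K * g x"
  obtains a where "(f has_sum a) A" "a \<le> K * b"
proof -
  have Kg: "((\<lambda>x. K * g x) has_sum K * b) A"
    using g by (rule has_sum_cmult_right)
  have "f summable_on A"
    by (rule summable_on_comparison_test[OF _ le nonneg]) (use Kg in \<open>auto simp: summable_on_def\<close>)
  then obtain a where "(f has_sum a) A"
    by (auto simp: summable_on_def)
  moreover from this Kg le have "a \<le> K * b"
    by (rule has_sum_mono)
  ultimately show thesis by (rule that)
qed

section \<open>Inequalities on a single clique\<close>

lemma cmod_sum_square_le: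
  "(cmod (\<Sum>i\<in>A. z i))\<^sup>2 \<le> real (card A) * (\<Sum>i\<in>A. (cmod (z i))\<^sup>2)"
proof -
  have "(cmod (\<Sum>i\<in>A. z i))\<^sup>2 \<le> (\<Sum>i\<in>A. cmod (z i))\<^sup>2"
    by (intro power_mono norm_sum) auto
  also have "\<dots> \<le> real (card A) * (\<Sum>i\<in>A. (cmod (z i))\<^sup>2)"
    using Cauchy_Schwarz_ineq_sum[of "\<lambda>_. 1" "\<lambda>i. cmod (z i)" A] by simp
  finally show ?thesis .
qed

lemma cmod_diff_square:
  "(cmod (a - b))\<^sup>2 = (cmod a)\<^sup>2 + (cmod b)\<^sup>2 - 2 * Re (a * cnj b)"
  by (simp only: cmod_power2) (simp add: power2_eq_square algebra_simps)

text \<open>The Laplacian of a complete graph on \<open>c\<close> is \<open>card c\<close> times the projection onto the functions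
  of mean zero; this is its quadratic form.\<close>

lemma sum_pair_differences:
  fixes v :: "'a \<Rightarrow> complex"
  shows "(\<Sum>x\<in>c. \<Sum>y\<in>c. (cmod (v y - v x))\<^sup>2)
       = 2 * real (card c) * (\<Sum>x\<in>c. (cmod (v x))\<^sup>2) - 2 * (cmod (\<Sum>x\<in>c. v x))\<^sup>2"
proof -
  have "(\<Sum>x\<in>c. \<Sum>y\<in>c. Re (v y * cnj (v x))) = Re ((\<Sum>y\<in>c. v y) * cnj (\<Sum>x\<in>c. v x))"
    by (simp only: sum_product cnj_sum Re_sum) (rule sum.swap)
  also have "\<dots> = (cmod (\<Sum>x\<in>c. v x))\<^sup>2"
    by (simp only: complex_norm_square[symmetric] Re_complex_of_real)
  finally show ?thesis
    by (simp add: cmod_diff_square sum.distrib sum_subtractf sum_distrib_left[symmetric])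
qed

text \<open>The adjoint statement: on a complete graph with \<open>k\<close> vertices the divergence has squared norm
  at most \<open>k\<close>. With \<open>g\<close> the divergence of \<open>f\<close>, expand the square of \<open>k f - d g\<close>: since \<open>g\<close> has
  total \<open>0\<close>, the square of \<open>d g\<close> is known exactly, and the cross terms are again multiples of the
  square of \<open>g\<close>. Both sides carry a factor 2 because every edge occurs in both orientations.\<close>

lemma clique_divergence_bound:
  fixes f :: "'a \<times> 'a \<Rightarrow> complex"
  assumes anti: "\<And>x y. x \<in> c \<Longrightarrow> y \<in> c \<Longrightarrow> f (y, x) = - f (x, y)"
  shows "2 * (\<Sum>x\<in>c. (cmod (\<Sum>y\<in>c. f (y, x)))\<^sup>2)
       \<le> real (card c) * (\<Sum>x\<in>c. \<Sum>y\<in>c. (cmod (f (x, y)))\<^sup>2)"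
proof (cases "card c = 0")
  case True
  then show ?thesis by (cases "finite c") auto
next
  case False
  define k where "k = real (card c)"
  define g where "g x = (\<Sum>y\<in>c. f (y, x))" for x
  define W where "W = (\<Sum>x\<in>c. (cmod (g x))\<^sup>2)"
  define Q where "Q = (\<Sum>x\<in>c. \<Sum>y\<in>c. (cmod (f (x, y)))\<^sup>2)"
  have k: "k > 0" using False by (simp add: k_def)
  have g_total: "(\<Sum>x\<in>c. g x) = 0"
  proof -
    have "(\<Sum>x\<in>c. g x) = (\<Sum>x\<in>c. \<Sum>y\<in>c. f (x, y))"
      unfolding g_def by (rule sum.swap)
    also have "\<dots> = (\<Sum>x\<in>c. \<Sum>y\<in>c. - f (y, x))"
      by (intro sum.cong refl anti)
    also have "\<dots> = - (\<Sum>x\<in>c. g x)"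
      by (simp add: g_def sum_negf)
    finally show ?thesis by simp
  qed
  have grad: "(\<Sum>x\<in>c. \<Sum>y\<in>c. (cmod (g y - g x))\<^sup>2) = 2 * k * W"
    by (simp add: sum_pair_differences g_total k_def W_def)
  have cross1: "(\<Sum>x\<in>c. \<Sum>y\<in>c. Re (f (x, y) * cnj (g y))) = W"
  proof -
    have "(\<Sum>x\<in>c. \<Sum>y\<in>c. Re (f (x, y) * cnj (g y))) = (\<Sum>y\<in>c. Re (g y * cnj (g y)))"
      unfolding g_def by (subst sum.swap) (simp add: sum_distrib_right)
    also have "\<dots> = W" unfolding W_def by (simp flip: complex_norm_square)
    finally show ?thesis .
  qed
  have cross2: "(\<Sum>x\<in>c. \<Sum>y\<in>c. Re (f (x, y) * cnj (g x))) = - W"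
  proof -
    have "(\<Sum>x\<in>c. \<Sum>y\<in>c. Re (f (x, y) * cnj (g x))) = (\<Sum>x\<in>c. \<Sum>y\<in>c. - Re (f (y, x) * cnj (g x)))"
    proof (intro sum.cong refl)
      fix x y assume "x \<in> c" "y \<in> c"
      then have "f (x, y) = - f (y, x)" by (intro anti)
      then show "Re (f (x, y) * cnj (g x)) = - Re (f (y, x) * cnj (g x))" by simp
    qed
    also have "\<dots> = (\<Sum>x\<in>c. - Re (g x * cnj (g x)))"
      unfolding g_def by (simp only: sum_distrib_right Re_sum sum_negf)
    also have "\<dots> = - W" unfolding W_def by (simp add: sum_negf flip: complex_norm_square)
    finally show ?thesis .
  qed
  have "0 \<le> (\<Sum>x\<in>c. \<Sum>y\<in>c. (cmod (of_real k * f (x, y) - (g y - g x)))\<^sup>2)"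
    by (intro sum_nonneg) auto
  also have "\<dots> = (\<Sum>x\<in>c. \<Sum>y\<in>c. k\<^sup>2 * (cmod (f (x, y)))\<^sup>2 + (cmod (g y - g x))\<^sup>2
      - 2 * k * Re (f (x, y) * cnj (g y)) + 2 * k * Re (f (x, y) * cnj (g x)))"
    by (intro sum.cong refl, subst cmod_diff_square)
      (simp add: norm_mult power_mult_distrib algebra_simps)
  also have "\<dots> = k\<^sup>2 * Q + (\<Sum>x\<in>c. \<Sum>y\<in>c. (cmod (g y - g x))\<^sup>2)
      - 2 * k * (\<Sum>x\<in>c. \<Sum>y\<in>c. Re (f (x, y) * cnj (g y)))
      + 2 * k * (\<Sum>x\<in>c. \<Sum>y\<in>c. Re (f (x, y) * cnj (g x)))"
    by (simp only: Q_def sum.distrib sum_subtractf sum_distrib_left)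
  also have "\<dots> = k\<^sup>2 * Q - 2 * k * W"
    unfolding grad cross1 cross2 by simp
  finally have "k * (2 * W) \<le> k * (k * Q)" by (simp add: power2_eq_square algebra_simps)
  then show ?thesis using k by (simp add: W_def Q_def g_def k_def)
qed

section \<open>The norm of a cochain as a sum over oriented edges\<close>

lemma cochain_antisym:
  assumes "f \<in> cochains1 G" "sym (oriented_edges G)"
  shows "f (y, x) = - f (x, y)"
proof (cases "(x, y) \<in> oriented_edges G")
  case True
  then show ?thesis using assms(1) unfolding cochains1_def by blast
next
  case False
  then have "(y, x) \<notin> oriented_edges G" using assms(2) by (auto dest: symD)
  with False show ?thesis using assms(1) unfolding cochains1_def by simp
qed

lemma has_sum_oriented_edges_iff:
  assumes f: "f \<in> cochains1 G" and sym: "sym (oriented_edges G)" and irr: "irrefl (oriented_edges G)"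
  shows "((\<lambda>p. (cmod (f p))\<^sup>2) has_sum 2 * s) (oriented_edges G)
    \<longleftrightarrow> ((\<lambda>e. (cmod (f (orient e)))\<^sup>2) has_sum s) (edges G)"
proof -
  let ?O = "oriented_edges G"
  have fib: "{p \<in> ?O. {fst p, snd p} = {x, y}} = {(x, y), (y, x)}" if "(x, y) \<in> ?O" for x y
    using that sym by (auto simp: doubleton_eq_iff dest: symD)
  have fibsum: "finite {p \<in> ?O. {fst p, snd p} = e}
      \<and> (\<Sum>p | p \<in> ?O \<and> {fst p, snd p} = e. (cmod (f p))\<^sup>2) = 2 * (cmod (f (orient e)))\<^sup>2"
    if "e \<in> edges G" for e
  proof -
    from that obtain x y where e: "e = {x, y}" and xy: "(x, y) \<in> ?O"
      by (auto simp: edges_def)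
    have "x \<noteq> y" using xy irr by (auto simp: irrefl_def)
    then show ?thesis
      using cochain_antisym[OF f sym, of y x] cmod_orient[OF f xy]
      by (simp add: e fib[OF xy])
  qed
  have "((\<lambda>p. (cmod (f p))\<^sup>2) has_sum 2 * s) ?O
    \<longleftrightarrow> ((\<lambda>e. \<Sum>p | p \<in> ?O \<and> {fst p, snd p} = e. (cmod (f p))\<^sup>2) has_sum 2 * s) (edges G)"
  proof (rule has_sum_fibres)
    show "{fst p, snd p} \<in> edges G" if "p \<in> ?O" for p
      using that unfolding edges_def by (cases p) auto
    show "finite {p \<in> ?O. {fst p, snd p} = e}" if "e \<in> edges G" for e
      using fibsum[OF that] by blast
  qed simp
  also have "\<dots> \<longleftrightarrow> ((\<lambda>e. 2 * (cmod (f (orient e)))\<^sup>2) has_sum 2 * s) (edges G)"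
    using fibsum by (intro has_sum_cong) blast
  also have "\<dots> \<longleftrightarrow> ((\<lambda>e. (cmod (f (orient e)))\<^sup>2) has_sum s) (edges G)"
    using has_sum_cmult_right[of "\<lambda>e. 2 * (cmod (f (orient e)))\<^sup>2" "edges G" "2 * s" "1/2"]
      has_sum_cmult_right[of "\<lambda>e. (cmod (f (orient e)))\<^sup>2" "edges G" s 2] by auto
  finally show ?thesis .
qed

lemma l2_cochain_has_sum:
  assumes f: "f \<in> l2_cochains1 G" and "sym (oriented_edges G)" "irrefl (oriented_edges G)"
  shows "((\<lambda>p. (cmod (f p))\<^sup>2) has_sum 2 * (cochain_norm G f)\<^sup>2) (oriented_edges G)"
proof -
  have "((\<lambda>e. (cmod (f (orient e)))\<^sup>2) has_sum (\<Sum>\<^sub>\<infinity>e\<in>edges G. (cmod (f (orient e)))\<^sup>2)) (edges G)"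
    using f by (simp add: l2_cochains1_def)
  then have "((\<lambda>e. (cmod (f (orient e)))\<^sup>2) has_sum (cochain_norm G f)\<^sup>2) (edges G)"
    unfolding cochain_norm_def by (subst real_sqrt_pow2) (auto intro: infsum_nonneg)
  then show ?thesis
    using f assms by (subst has_sum_oriented_edges_iff) (auto simp: l2_cochains1_def)
qed

lemma l2_cochainI:
  assumes f: "f \<in> cochains1 G" and "sym (oriented_edges G)" "irrefl (oriented_edges G)"
    and s: "((\<lambda>p. (cmod (f p))\<^sup>2) has_sum 2 * s) (oriented_edges G)"
  shows "f \<in> l2_cochains1 G" "(cochain_norm G f)\<^sup>2 = s"
proof -
  have *: "((\<lambda>e. (cmod (f (orient e)))\<^sup>2) has_sum s) (edges G)"
    using has_sum_oriented_edges_iff[of f G s] assms by simp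
  then show "f \<in> l2_cochains1 G"
    using f by (auto simp: l2_cochains1_def summable_on_def)
  from * have "0 \<le> s" by (rule has_sum_nonneg) auto
  with infsumI[OF *] show "(cochain_norm G f)\<^sup>2 = s"
    by (simp add: cochain_norm_def)
qed

lemma edge_laplacian_cochain:
  assumes "sym (oriented_edges G)"
  shows "edge_laplacian G f \<in> cochains1 G"
  using assms by (auto simp: edge_laplacian_def coboundary1_def cochains1_def dest: symD)

section \<open>Graphs whose edges are partitioned into cliques\<close>

text \<open>Cliques are represented by their vertex sets, so that uniqueness of the clique through an edge
  is an equality of sets. The case \<open>k = 2\<close>, with \<open>C\<close> the set of edges, covers every regular graph.\<close>

locale clique_partition =
  fixes G :: "'v graph" and C :: "'v set set" and k m :: nat
  assumes clique_subset: "c \<in> C \<Longrightarrow> c \<subseteq> vertices G"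
    and clique_finite: "c \<in> C \<Longrightarrow> finite c"
    and clique_card: "c \<in> C \<Longrightarrow> card c = k"
    and cliques_finite: "x \<in> vertices G \<Longrightarrow> finite {c \<in> C. x \<in> c}"
    and cliques_card: "x \<in> vertices G \<Longrightarrow> card {c \<in> C. x \<in> c} = m"
    and edge_iff: "(x, y) \<in> oriented_edges G \<longleftrightarrow> x \<noteq> y \<and> (\<exists>c\<in>C. x \<in> c \<and> y \<in> c)"
    and clique_unique: "\<lbrakk>c \<in> C; c' \<in> C; x \<noteq> y; x \<in> c; y \<in> c; x \<in> c'; y \<in> c'\<rbrakk> \<Longrightarrow> c = c'"
begin

lemma edges_sym: "sym (oriented_edges G)"
  by (rule symI) (auto simp: edge_iff)

lemma edges_irrefl: "irrefl (oriented_edges G)"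
  by (auto simp: irrefl_def edge_iff)

lemma nbrs_eq: "nbrs G x = (\<Union>c\<in>{c \<in> C. x \<in> c}. c - {x})"
  by (auto simp: nbrs_def edge_iff)

lemma sum_nbrs:
  assumes "x \<in> vertices G"
  shows "sum h (nbrs G x) = (\<Sum>c | c \<in> C \<and> x \<in> c. sum h (c - {x}))"
  unfolding nbrs_eq
proof (rule sum.UNION_disjoint)
  show "\<forall>c\<in>{c \<in> C. x \<in> c}. \<forall>c'\<in>{c \<in> C. x \<in> c}. c \<noteq> c' \<longrightarrow> (c - {x}) \<inter> (c' - {x}) = {}"
    using clique_unique by blast
qed (use assms cliques_finite clique_finite in auto)

lemma finite_nbrs: "x \<in> vertices G \<Longrightarrow> finite (nbrs G x)"
  using cliques_finite clique_finite by (auto simp: nbrs_eq)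

lemma card_nbrs:
  assumes x: "x \<in> vertices G"
  shows "card (nbrs G x) = (k - 1) * m"
proof -
  have "card (nbrs G x) = (\<Sum>c | c \<in> C \<and> x \<in> c. card (c - {x}))"
    using sum_nbrs[OF x, of "\<lambda>_. 1::nat"] by simp
  also have "\<dots> = (\<Sum>c | c \<in> C \<and> x \<in> c. k - 1)"
    by (intro sum.cong) (auto simp: clique_card clique_finite)
  finally show ?thesis by (simp add: cliques_card[OF x])
qed

lemma regular: "regular_graph G ((k - 1) * m)"
  by (simp add: regular_graph_def edges_sym edges_irrefl finite_nbrs card_nbrs)

lemma edge_sum:
  fixes h :: "'v \<times> 'v \<Rightarrow> real"
  assumes nonneg: "\<And>p. 0 \<le> h p" and diag: "\<And>x. h (x, x) = 0"
  shows "(h has_sum s) (oriented_edges G) \<longleftrightarrow> ((\<lambda>c. \<Sum>x\<in>c. \<Sum>y\<in>c. h (x, y)) has_sum s) C"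
proof -
  let ?O = "oriented_edges G"
  define cl where "cl p = (THE c. c \<in> C \<and> fst p \<in> c \<and> snd p \<in> c)" for p :: "'v \<times> 'v"
  have cl: "cl (x, y) = c" if "c \<in> C" "x \<noteq> y" "x \<in> c" "y \<in> c" for c x y
    unfolding cl_def using that clique_unique by (intro the_equality) auto
  have clO: "cl p \<in> C \<and> fst p \<in> cl p \<and> snd p \<in> cl p" if "p \<in> ?O" for p
    using that cl by (cases p) (auto simp: edge_iff)
  have fib: "{p \<in> ?O. cl p = c} = {p \<in> c \<times> c. fst p \<noteq> snd p}" if "c \<in> C" for c
    using that cl by (auto simp: edge_iff)
  have "(h has_sum s) ?O \<longleftrightarrow> ((\<lambda>c. \<Sum>p | p \<in> ?O \<and> cl p = c. h p) has_sum s) C"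
    by (rule has_sum_fibres) (use nonneg clO clique_finite in \<open>auto simp: fib\<close>)
  also have "\<dots> \<longleftrightarrow> ((\<lambda>c. \<Sum>x\<in>c. \<Sum>y\<in>c. h (x, y)) has_sum s) C"
  proof (rule has_sum_cong)
    fix c assume c: "c \<in> C"
    have "(\<Sum>p | p \<in> ?O \<and> cl p = c. h p) = (\<Sum>p\<in>c \<times> c. h p)"
      unfolding fib[OF c] using c clique_finite diag by (intro sum.mono_neutral_left) auto
    then show "(\<Sum>p | p \<in> ?O \<and> cl p = c. h p) = (\<Sum>x\<in>c. \<Sum>y\<in>c. h (x, y))"
      by (simp add: sum.cartesian_product case_prod_unfold)
  qed
  finally show ?thesis .
qed

lemma incidence_sum:
  fixes h :: "'v \<Rightarrow> 'v set \<Rightarrow> real"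
  assumes nonneg: "\<And>x c. 0 \<le> h x c"
  shows "((\<lambda>x. \<Sum>c | c \<in> C \<and> x \<in> c. h x c) has_sum s) (vertices G)
    \<longleftrightarrow> ((\<lambda>c. \<Sum>x\<in>c. h x c) has_sum s) C"
proof -
  let ?I = "{(x, c). c \<in> C \<and> x \<in> c}"
  have fib1: "{p. p \<in> ?I \<and> fst p = x} = Pair x ` {c \<in> C. x \<in> c}" for x by auto
  have fib2: "{p. p \<in> ?I \<and> snd p = c} = (\<lambda>x. (x, c)) ` c" if "c \<in> C" for c using that by auto
  have "((\<lambda>x. \<Sum>p | p \<in> ?I \<and> fst p = x. (case_prod h) p) has_sum s) (vertices G)
    \<longleftrightarrow> (case_prod h has_sum s) ?I"
  proof (rule has_sum_fibres[symmetric])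
    show "finite {p \<in> ?I. fst p = x}" if "x \<in> vertices G" for x
      unfolding fib1 using cliques_finite[OF that] by simp
    show "fst p \<in> vertices G" if "p \<in> ?I" for p
      using that clique_subset by (cases p) auto
  qed (use nonneg in auto)
  also have "\<dots> \<longleftrightarrow> ((\<lambda>c. \<Sum>p | p \<in> ?I \<and> snd p = c. (case_prod h) p) has_sum s) C"
  proof (rule has_sum_fibres)
    show "finite {p \<in> ?I. snd p = c}" if "c \<in> C" for c
      unfolding fib2[OF that] using clique_finite[OF that] by simp
  qed (use nonneg in auto)
  also have "\<dots> \<longleftrightarrow> ((\<lambda>c. \<Sum>x\<in>c. h x c) has_sum s) C"
    by (rule has_sum_cong, subst fib2) (auto simp: sum.reindex inj_on_def)
  finally show ?thesis
    unfolding fib1 by (simp add: sum.reindex inj_on_def)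
qed

text \<open>At a vertex the divergence is the sum of the \<open>m\<close> divergences inside the cliques through it, which
  costs a factor \<open>m\<close> by Cauchy-Schwarz; inside each clique there is a factor \<open>k\<close>.\<close>

lemma boundary_bound:
  assumes f: "f \<in> cochains1 G"
    and q: "((\<lambda>p. (cmod (f p))\<^sup>2) has_sum q) (oriented_edges G)"
  obtains r where "((\<lambda>x. (cmod (boundary1 G f x))\<^sup>2) has_sum r) (vertices G)" "2 * r \<le> real (k * m) * q"
proof -
  have anti: "f (y, x) = - f (x, y)" for x y
    by (rule cochain_antisym[OF f edges_sym])
  have diag: "f (x, x) = 0" for x using anti[of x x] by simp
  define part where "part x c = (cmod (\<Sum>y\<in>c. f (y, x)))\<^sup>2" for x c
  have "((\<lambda>c. \<Sum>x\<in>c. \<Sum>y\<in>c. (cmod (f (x, y)))\<^sup>2) has_sum q) C"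
    using q by (subst (asm) edge_sum) (auto simp: diag)
  then obtain r' where r': "((\<lambda>c. \<Sum>x\<in>c. part x c) has_sum r') C" "r' \<le> (real k / 2) * q"
  proof (rule has_sum_dominated)
    fix c assume c: "c \<in> C"
    show "(\<Sum>x\<in>c. part x c) \<le> (real k / 2) * (\<Sum>x\<in>c. \<Sum>y\<in>c. (cmod (f (x, y)))\<^sup>2)"
      using clique_divergence_bound[of c f, OF anti] by (simp add: part_def clique_card[OF c])
  qed (auto simp: part_def intro: sum_nonneg)
  have "((\<lambda>x. \<Sum>c | c \<in> C \<and> x \<in> c. part x c) has_sum r') (vertices G)"
    using r'(1) by (subst incidence_sum) (auto simp: part_def)
  then obtain r where r: "((\<lambda>x. (cmod (boundary1 G f x))\<^sup>2) has_sum r) (vertices G)" "r \<le> real m * r'"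
  proof (rule has_sum_dominated)
    fix x assume x: "x \<in> vertices G"
    have "boundary1 G f x = (\<Sum>c | c \<in> C \<and> x \<in> c. \<Sum>y\<in>c. f (y, x))"
      unfolding boundary1_def sum_nbrs[OF x]
      by (intro sum.cong refl sum.mono_neutral_left) (auto simp: clique_finite diag)
    then show "(cmod (boundary1 G f x))\<^sup>2 \<le> real m * (\<Sum>c | c \<in> C \<and> x \<in> c. part x c)"
      using cmod_sum_square_le[of "\<lambda>c. \<Sum>y\<in>c. f (y, x)" "{c \<in> C. x \<in> c}"]
      by (simp add: part_def cliques_card[OF x])
  qed auto
  have "r \<le> real m * ((real k / 2) * q)"
    using r(2) r'(2) by (meson mult_left_mono of_nat_0_le_iff order_trans)
  then show thesis using r(1) by (intro that[of r]) (auto simp: algebra_simps)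
qed

text \<open>Each vertex value is counted once for each of the \<open>m\<close> cliques through the vertex, and each clique
  contributes a factor \<open>k\<close>. Here and in the previous lemma the oriented sum over edges is twice the
  squared norm.\<close>

lemma coboundary_bound:
  assumes r: "((\<lambda>x. (cmod (v x))\<^sup>2) has_sum r) (vertices G)"
  obtains t where "((\<lambda>p. (cmod (coboundary1 G v p))\<^sup>2) has_sum t) (oriented_edges G)"
    "t \<le> 2 * real (k * m) * r"
proof -
  have "((\<lambda>x. \<Sum>c | c \<in> C \<and> x \<in> c. (cmod (v x))\<^sup>2) has_sum real m * r) (vertices G)
      \<longleftrightarrow> ((\<lambda>x. real m * (cmod (v x))\<^sup>2) has_sum real m * r) (vertices G)"
    by (rule has_sum_cong) (simp add: cliques_card)
  then have "((\<lambda>c. \<Sum>x\<in>c. (cmod (v x))\<^sup>2) has_sum real m * r) C"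
    using has_sum_cmult_right[OF r, of "real m"]
    by (subst (asm) incidence_sum) auto
  then obtain t where t: "((\<lambda>c. \<Sum>x\<in>c. \<Sum>y\<in>c. (cmod (v y - v x))\<^sup>2) has_sum t) C"
      "t \<le> (2 * real k) * (real m * r)"
  proof (rule has_sum_dominated)
    fix c assume "c \<in> C"
    then show "(\<Sum>x\<in>c. \<Sum>y\<in>c. (cmod (v y - v x))\<^sup>2) \<le> 2 * real k * (\<Sum>x\<in>c. (cmod (v x))\<^sup>2)"
      by (simp add: sum_pair_differences clique_card)
  qed (auto intro!: sum_nonneg)
  have "((\<lambda>p. (cmod (v (snd p) - v (fst p)))\<^sup>2) has_sum t) (oriented_edges G)"
    using t(1) by (subst edge_sum) auto
  also have "?this \<longleftrightarrow> ((\<lambda>p. (cmod (coboundary1 G v p))\<^sup>2) has_sum t) (oriented_edges G)"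
    by (intro has_sum_cong) (auto simp: coboundary1_def)
  finally have "((\<lambda>p. (cmod (coboundary1 G v p))\<^sup>2) has_sum t) (oriented_edges G)" .
  then show thesis using t(2) by (intro that[of t]) (auto simp: algebra_simps)
qed

lemma edge_laplacian_bound:
  assumes f: "f \<in> l2_cochains1 G"
  shows "edge_laplacian G f \<in> l2_cochains1 G"
    and "cochain_norm G (edge_laplacian G f) \<le> real (k * m) * cochain_norm G f"
proof -
  have f1: "f \<in> cochains1 G" using f by (simp add: l2_cochains1_def)
  obtain r where r: "((\<lambda>x. (cmod (boundary1 G f x))\<^sup>2) has_sum r) (vertices G)"
      "2 * r \<le> real (k * m) * (2 * (cochain_norm G f)\<^sup>2)"
    using boundary_bound[OF f1 l2_cochain_has_sum[OF f edges_sym edges_irrefl]] .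
  obtain t where t: "((\<lambda>p. (cmod (edge_laplacian G f p))\<^sup>2) has_sum t) (oriented_edges G)"
      "t \<le> 2 * real (k * m) * r"
    using coboundary_bound[OF r(1)] unfolding edge_laplacian_def .
  note * = l2_cochainI[OF edge_laplacian_cochain[OF edges_sym] edges_sym edges_irrefl, of f "t / 2"]
  show "edge_laplacian G f \<in> l2_cochains1 G" using * t by simp
  have "(cochain_norm G (edge_laplacian G f))\<^sup>2 = t / 2" using * t by simp
  also have "\<dots> \<le> real (k * m) * r" using t(2) by simp
  also have "\<dots> \<le> real (k * m) * (real (k * m) * (cochain_norm G f)\<^sup>2)"
    using r(2) by (intro mult_left_mono) auto
  also have "\<dots> = (real (k * m) * cochain_norm G f)\<^sup>2"
    by (simp add: power2_eq_square algebra_simps)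
  finally show "cochain_norm G (edge_laplacian G f) \<le> real (k * m) * cochain_norm G f"
    by (rule power2_le_imp_le) (simp add: cochain_norm_def infsum_nonneg)
qed

end

section \<open>A lower bound from a unimodular eigenfunction\<close>

lemma exp_beats_poly:
  fixes r B a :: real
  assumes r: "1 < r" and a: "0 < a" and le: "\<And>n. r ^ n * a \<le> B * (2 * real n + 3) ^ j"
  shows False
proof -
  have "(\<lambda>n. B * (2 * real n + 3) ^ j / r ^ n) \<longlonglongrightarrow> 0"
    using r by real_asymp
  moreover have "a \<le> B * (2 * real n + 3) ^ j / r ^ n" for n
    using le[of n] r by (simp add: pos_le_divide_eq mult.commute)
  ultimately have "a \<le> 0"
    by (intro tendsto_lowerbound) auto
  with a show False by simp
qed

lemma cochain_norm_nonneg: "0 \<le> cochain_norm G f"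
  by (simp add: cochain_norm_def infsum_nonneg)

lemma l2_cochain_scale:
  assumes f: "f \<in> l2_cochains1 G"
  shows "(\<lambda>e. c * f e) \<in> l2_cochains1 G"
    and "cochain_norm G (\<lambda>e. c * f e) = cmod c * cochain_norm G f"
proof -
  have sum: "((\<lambda>e. (cmod (f (orient e)))\<^sup>2) summable_on edges G)"
    using f by (simp add: l2_cochains1_def)
  have sq: "(\<lambda>e. (cmod (c * f (orient e)))\<^sup>2) = (\<lambda>e. (cmod c)\<^sup>2 * (cmod (f (orient e)))\<^sup>2)"
    by (simp add: norm_mult power_mult_distrib)
  show "(\<lambda>e. c * f e) \<in> l2_cochains1 G"
    using f summable_on_cmult_right[OF sum] by (auto simp: l2_cochains1_def cochains1_def sq)
  show "cochain_norm G (\<lambda>e. c * f e) = cmod c * cochain_norm G f"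
    using infsum_cmult_right[of "(cmod c)\<^sup>2" "\<lambda>e. (cmod (f (orient e)))\<^sup>2" "edges G"] sum
    by (simp add: cochain_norm_def sq real_sqrt_mult)
qed

lemma edge_laplacian_scale:
  "edge_laplacian G (\<lambda>e. c * f e) = (\<lambda>e. c * edge_laplacian G f e)"
  by (auto simp: edge_laplacian_def coboundary1_def boundary1_def fun_eq_iff
      simp flip: sum_distrib_left right_diff_distrib)

text \<open>Boundedness makes the supremum in the definition of the operator norm an honest one, and scaling
  passes from the unit ball to all cochains.\<close>

lemma l2_onorm_upper:
  assumes bnd: "l2_bounded G (edge_laplacian G)" and f: "f \<in> l2_cochains1 G"
  shows "cochain_norm G (edge_laplacian G f) \<le> l2_onorm G (edge_laplacian G) * cochain_norm G f"
proof -
  obtain B where B: "\<And>f. f \<in> l2_cochains1 G \<Longrightarrow> cochain_norm G (edge_laplacian G f) \<le> B * cochain_norm G f"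
    using bnd by (auto simp: l2_bounded_def)
  show ?thesis
  proof (cases "cochain_norm G f = 0")
    case True
    then show ?thesis using B[OF f] by simp
  next
    case False
    then have pos: "cochain_norm G f > 0"
      using cochain_norm_nonneg[of G f] by simp
    define c :: complex where "c = of_real (1 / cochain_norm G f)"
    have c: "cmod c = 1 / cochain_norm G f"
      using pos by (simp add: c_def norm_divide)
    let ?U = "{f \<in> l2_cochains1 G. cochain_norm G f \<le> 1}"
    have "bdd_above ((\<lambda>f. cochain_norm G (edge_laplacian G f)) ` ?U)"
    proof (rule bdd_aboveI2)
      fix h assume h: "h \<in> ?U"
      have "cochain_norm G (edge_laplacian G h) \<le> B * cochain_norm G h"
        using B h by simp
      also have "\<dots> \<le> \<bar>B\<bar> * 1"
        using h cochain_norm_nonneg[of G h] by (intro mult_mono) auto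
      finally show "cochain_norm G (edge_laplacian G h) \<le> \<bar>B\<bar>" by simp
    qed
    then have "cochain_norm G (edge_laplacian G (\<lambda>e. c * f e)) \<le> l2_onorm G (edge_laplacian G)"
      unfolding l2_onorm_def
      by (rule cSUP_upper[rotated]) (use l2_cochain_scale[OF f] pos c in simp)
    moreover have "edge_laplacian G f \<in> l2_cochains1 G"
      using bnd f by (simp add: l2_bounded_def)
    ultimately show ?thesis
      using pos by (simp add: edge_laplacian_scale l2_cochain_scale(2) c pos_divide_le_eq)
  qed
qed

lemma l2_onorm_le:
  assumes "\<And>f. f \<in> l2_cochains1 G \<Longrightarrow> cochain_norm G (edge_laplacian G f) \<le> B * cochain_norm G f"
    and "0 \<le> B"
  shows "l2_onorm G (edge_laplacian G) \<le> B"
  unfolding l2_onorm_def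
proof (rule cSUP_least)
  have "(\<lambda>_. 0) \<in> l2_cochains1 G" "cochain_norm G (\<lambda>_. 0) = 0"
    by (simp_all add: l2_cochains1_def cochains1_def cochain_norm_def)
  then show "{f \<in> l2_cochains1 G. cochain_norm G f \<le> 1} \<noteq> {}" by force
next
  fix f assume f: "f \<in> {f \<in> l2_cochains1 G. cochain_norm G f \<le> 1}"
  then have "cochain_norm G (edge_laplacian G f) \<le> B * cochain_norm G f"
    using assms by simp
  also have "\<dots> \<le> B * 1"
    using f assms(2) by (intro mult_left_mono) auto
  finally show "cochain_norm G (edge_laplacian G f) \<le> B" by simp
qed

text \<open>Polynomial growth of the sets \<open>F n\<close> is what makes the lattices amenable: a neighbourhood of \<open>F n\<close>
  cannot be larger than \<open>F n\<close> by a fixed factor for all \<open>n\<close>. Points outside the graph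
  are admitted so that plain boxes of coordinates qualify.\<close>

definition poly_exhaustion :: "'v graph \<Rightarrow> (nat \<Rightarrow> 'v set) \<Rightarrow> bool" where
  "poly_exhaustion G F \<longleftrightarrow>
     (\<forall>n. F n \<subseteq> F (Suc n)) \<and> (\<forall>n. \<forall>x\<in>F n. nbrs G x \<subseteq> F (Suc n)) \<and>
     F 0 \<inter> vertices G \<noteq> {} \<and>
     (\<exists>K j. \<forall>n. finite (F n) \<and> card (F n) \<le> K * (2 * n + 1) ^ j)"

text \<open>The coboundary \<open>w\<close> of \<open>u\<close> satisfies \<open>edge_laplacian G w = L w\<close> but is not square summable. Let \<open>f n\<close> be
  its restriction to the edges inside \<open>F n\<close>. The Laplacian of \<open>f (n + 1)\<close> still equals \<open>L w\<close> inside
  \<open>F n\<close>, because the divergence at a point of \<open>F n\<close> sees only edges inside \<open>F (n + 1)\<close>. If the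
  operator norm were at most \<open>q < L\<close>, the square sums \<open>a n\<close> of \<open>w\<close> inside \<open>F n\<close> would thus grow by the
  factor \<open>(L / q)\<^sup>2 > 1\<close> at each step,
  against polynomial growth.\<close>

lemma l2_onorm_ge:
  fixes u :: "'v \<Rightarrow> complex"
  assumes reg: "regular_graph G d" and bnd: "l2_bounded G (edge_laplacian G)"
    and exh: "poly_exhaustion G F"
    and u: "\<And>x. x \<in> vertices G \<Longrightarrow> cmod (u x) = 1"
    and eig: "\<And>x. x \<in> vertices G \<Longrightarrow> (\<Sum>y\<in>nbrs G x. u x - u y) = of_real L * u x"
    and L: "0 < L"
  shows "L \<le> l2_onorm G (edge_laplacian G)"
proof (rule ccontr)
  assume neg: "\<not> L \<le> l2_onorm G (edge_laplacian G)"
  let ?O = "oriented_edges G"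
  have sym: "sym ?O" and irr: "irrefl ?O"
    and deg: "\<And>x. x \<in> vertices G \<Longrightarrow> finite (nbrs G x) \<and> card (nbrs G x) = d"
    using reg by (auto simp: regular_graph_def)
  obtain K j where Kj: "\<forall>n. finite (F n) \<and> card (F n) \<le> K * (2 * n + 1) ^ j"
    using exh unfolding poly_exhaustion_def by blast
  then have fin: "\<And>n. finite (F n)" and card: "\<And>n. card (F n) \<le> K * (2 * n + 1) ^ j"
    by blast+
  have step: "\<And>n. F n \<subseteq> F (Suc n)" "\<And>n x. x \<in> F n \<Longrightarrow> nbrs G x \<subseteq> F (Suc n)"
    using exh by (auto simp: poly_exhaustion_def)
  obtain x\<^sub>0 where x0: "x\<^sub>0 \<in> F 0" "x\<^sub>0 \<in> vertices G"
    using exh by (auto simp: poly_exhaustion_def)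
  have edge_vertices: "fst p \<in> vertices G" "snd p \<in> vertices G" "snd p \<in> nbrs G (fst p)" if "p \<in> ?O" for p
    using that by (auto simp: oriented_edges_def nbrs_def)

  \<comment> \<open>The maximum with \<open>L / 2\<close> keeps \<open>q\<close> positive, so that one can divide by it.\<close>
  define q where "q = max (l2_onorm G (edge_laplacian G)) (L / 2)"
  have q: "0 < q" "q < L" using neg L by (auto simp: q_def)
  have q_bound: "cochain_norm G (edge_laplacian G f) \<le> q * cochain_norm G f" if "f \<in> l2_cochains1 G" for f
    by (rule order_trans[OF l2_onorm_upper[OF bnd that] mult_right_mono])
      (simp_all add: q_def cochain_norm_nonneg)

  define D where "D n = {p \<in> ?O. fst p \<in> F n \<and> snd p \<in> F n}" for n
  define w where "w p = u (snd p) - u (fst p)" for p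
  define f where "f n p = (if p \<in> D n then w p else 0)" for n p
  define a where "a n = (\<Sum>p\<in>D n. (cmod (w p))\<^sup>2)" for n
  have finD: "finite (D n)" for n
    by (rule finite_subset[of _ "F n \<times> F n"]) (use fin in \<open>auto simp: D_def\<close>)
  have f_cochain: "f n \<in> cochains1 G" for n
    using sym by (auto simp: cochains1_def f_def D_def w_def dest: symD)
  have f_sum: "((\<lambda>p. (cmod (f n p))\<^sup>2) has_sum 2 * (a n / 2)) ?O" for n
    by (rule has_sum_finite_neutralI[OF finD[of n]]) (auto simp: D_def f_def a_def)
  note f_l2 = l2_cochainI[OF f_cochain sym irr f_sum]
  have lap: "edge_laplacian G (f (Suc n)) p = of_real L * w p" if p: "p \<in> D n" for n p
  proof -
    have bd: "boundary1 G (f (Suc n)) x = of_real L * u x" if x: "x \<in> F n" "x \<in> vertices G" for x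
    proof -
      have "(y, x) \<in> D (Suc n)" if "y \<in> nbrs G x" for y
        using that x step(1)[of n] step(2)[OF x(1)] sym by (auto simp: D_def nbrs_def dest: symD)
      then show ?thesis
        unfolding boundary1_def eig[OF x(2), symmetric]
        by (intro sum.cong) (auto simp: f_def w_def)
    qed
    show ?thesis
      using p edge_vertices[of p]
      by (cases p) (auto simp: D_def edge_laplacian_def coboundary1_def bd w_def right_diff_distrib)
  qed
  have growth: "(L / q)\<^sup>2 * a n \<le> a (Suc n)" for n
  proof -
    let ?g = "edge_laplacian G (f (Suc n))"
    have g: "?g \<in> l2_cochains1 G"
      using bnd f_l2(1) by (simp add: l2_bounded_def)
    have "(\<Sum>p\<in>D n. (cmod (?g p))\<^sup>2) \<le> 2 * (cochain_norm G ?g)\<^sup>2"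
      by (rule finite_sum_le_has_sum[OF l2_cochain_has_sum[OF g sym irr]])
        (use finD in \<open>auto simp: D_def\<close>)
    moreover have "(\<Sum>p\<in>D n. (cmod (?g p))\<^sup>2) = L\<^sup>2 * a n"
      by (simp add: lap norm_mult power_mult_distrib a_def sum_distrib_left)
    moreover have "(cochain_norm G ?g)\<^sup>2 \<le> (q * cochain_norm G (f (Suc n)))\<^sup>2"
      by (intro power_mono q_bound f_l2 cochain_norm_nonneg)
    ultimately have "L\<^sup>2 * a n \<le> q\<^sup>2 * a (Suc n)"
      by (simp add: power_mult_distrib f_l2(2))
    then show ?thesis using q by (simp add: power_divide pos_divide_le_eq mult.commute)
  qed
  have "0 < a 1"
  proof (rule ccontr)
    assume "\<not> 0 < a 1"
    moreover have "0 \<le> a 1" by (auto simp: a_def intro: sum_nonneg)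
    ultimately have "a 1 = 0" by simp
    then have zero: "w p = 0" if "p \<in> D 1" for p
      using that finD by (simp add: a_def sum_nonneg_eq_0_iff)
    have "(x\<^sub>0, y) \<in> D 1" if "y \<in> nbrs G x\<^sub>0" for y
      using that x0(1) step(1)[of 0] step(2)[of x\<^sub>0 0] by (auto simp: D_def nbrs_def)
    then have "(\<Sum>y\<in>nbrs G x\<^sub>0. u x\<^sub>0 - u y) = 0"
      using zero by (intro sum.neutral) (force simp: w_def)
    then show False using eig[OF x0(2)] u[OF x0(2)] L by auto
  qed
  moreover have "((L / q)\<^sup>2) ^ n * a 1 \<le> (4 * real d * real K) * (2 * real n + 3) ^ j" for n
  proof -
    have "((L / q)\<^sup>2) ^ n * a 1 \<le> a (Suc n)"
    proof (induction n)
      case (Suc n)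
      have "((L / q)\<^sup>2) ^ Suc n * a 1 \<le> (L / q)\<^sup>2 * a (Suc n)"
        using mult_left_mono[OF Suc, of "(L / q)\<^sup>2"] by (simp add: mult.assoc)
      also have "\<dots> \<le> a (Suc (Suc n))" by (rule growth)
      finally show ?case .
    qed simp
    also have "\<dots> \<le> (\<Sum>p\<in>D (Suc n). 4)"
      unfolding a_def
    proof (rule sum_mono)
      fix p assume "p \<in> D (Suc n)"
      then have "cmod (w p) \<le> 1 + 1"
        unfolding w_def using norm_triangle_ineq4[of "u (snd p)" "u (fst p)"] u edge_vertices[of p]
        by (simp add: D_def)
      from power_mono[OF this, of 2] show "(cmod (w p))\<^sup>2 \<le> 4" by simp
    qed
    also have "\<dots> \<le> 4 * real (K * (2 * n + 3) ^ j * d)"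
    proof -
      have "card (D (Suc n)) \<le> card (Sigma (F (Suc n) \<inter> vertices G) (nbrs G))"
        using fin deg edge_vertices by (intro card_mono finite_SigmaI) (auto simp: D_def)
      also have "\<dots> = card (F (Suc n) \<inter> vertices G) * d"
        using fin deg by (subst card_SigmaI) auto
      also have "\<dots> \<le> card (F (Suc n)) * d"
        using fin by (intro mult_right_mono card_mono) auto
      also have "\<dots> \<le> (K * (2 * n + 3) ^ j) * d"
        using card[of "Suc n"] by (intro mult_right_mono) (simp_all add: eval_nat_numeral)
      finally show ?thesis by (simp del: of_nat_mult)
    qed
    finally show ?thesis by (simp add: algebra_simps)
  qed
  moreover have "1 < (L / q)\<^sup>2" using q by simp
  ultimately show False by (intro exp_beats_poly)
qed

text \<open>A function with zero sum over every clique is an eigenfunction: each clique through \<open>x\<close>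
  contributes \<open>k u x\<close> to the vertex Laplacian at \<open>x\<close>. On such functions all the inequalities used for
  the upper bound are equalities, which is why the two bounds meet.\<close>

lemma (in clique_partition) laplacian_norm:
  fixes u :: "'v \<Rightarrow> complex"
  assumes exh: "poly_exhaustion G F"
    and unit: "\<And>x. x \<in> vertices G \<Longrightarrow> cmod (u x) = 1"
    and balanced: "\<And>c. c \<in> C \<Longrightarrow> (\<Sum>x\<in>c. u x) = 0"
    and km: "0 < k * m"
  shows "regular_graph G ((k - 1) * m)"
    and "l2_bounded G (edge_laplacian G)"
    and "l2_onorm G (edge_laplacian G) = real (k * m)"
proof -
  show reg: "regular_graph G ((k - 1) * m)" by (rule regular)
  show bnd: "l2_bounded G (edge_laplacian G)"
    using edge_laplacian_bound unfolding l2_bounded_def by blast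
  have eig: "(\<Sum>y\<in>nbrs G x. u x - u y) = of_real (real (k * m)) * u x" if x: "x \<in> vertices G" for x
  proof -
    have "(\<Sum>y\<in>nbrs G x. u x - u y) = (\<Sum>c | c \<in> C \<and> x \<in> c. \<Sum>y\<in>c. u x - u y)"
      unfolding sum_nbrs[OF x]
      by (intro sum.cong refl sum.mono_neutral_left) (auto simp: clique_finite)
    also have "\<dots> = (\<Sum>c | c \<in> C \<and> x \<in> c. of_nat k * u x)"
      by (intro sum.cong refl) (simp add: sum_subtractf balanced clique_card)
    finally show ?thesis by (simp add: cliques_card[OF x])
  qed
  show "l2_onorm G (edge_laplacian G) = real (k * m)"
  proof (rule antisym)
    show "l2_onorm G (edge_laplacian G) \<le> real (k * m)"
      using edge_laplacian_bound by (intro l2_onorm_le) auto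
    show "real (k * m) \<le> l2_onorm G (edge_laplacian G)"
      by (rule l2_onorm_ge[OF reg bnd exh unit eig]) (use km in auto)
  qed
qed

section \<open>Constructing exhaustions and clique partitions\<close>

definition int_cube :: "nat \<Rightarrow> (int ^ 'n) set" where
  "int_cube n = {x. \<forall>i. \<bar>x $ i\<bar> \<le> int n}"

lemma card_int_cube: "finite (int_cube n :: (int ^ 'n) set)" "card (int_cube n :: (int ^ 'n) set) \<le> (2 * n + 1) ^ CARD('n)"
proof -
  let ?P = "PiE (UNIV :: 'n set) (\<lambda>_. {- int n..int n})"
  have sub: "(int_cube n :: (int ^ 'n) set) \<subseteq> vec_lambda ` ?P"
  proof
    fix x :: "int ^ 'n" assume x: "x \<in> int_cube n"
    have "(\<lambda>i. x $ i) \<in> ?P"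
      using x by (auto simp: int_cube_def PiE_def abs_le_iff minus_le_iff)
    then show "x \<in> vec_lambda ` ?P"
      by (metis image_eqI vec_nth_inverse)
  qed
  have fin: "finite ?P" by (intro finite_PiE) auto
  then show "finite (int_cube n :: (int ^ 'n) set)" using sub by (rule finite_surj)
  have "card ?P = (2 * n + 1) ^ CARD('n)"
    by (simp add: card_PiE nat_add_distrib nat_mult_distrib flip: mult_2)
  moreover have "card (int_cube n :: (int ^ 'n) set) \<le> card ?P"
    using fin sub by (rule surj_card_le)
  ultimately show "card (int_cube n :: (int ^ 'n) set) \<le> (2 * n + 1) ^ CARD('n)" by simp
qed

text \<open>For lattices with several vertices per cell: each \<open>h \<in> H\<close> places one kind of vertex at the points of
  an integer grid, and edges join vertices in cells that differ by at most one in each coordinate.\<close>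

lemma poly_exhaustion_cells:
  fixes H :: "(int ^ 'n \<Rightarrow> 'v) set"
  assumes H: "finite H" and origin: "h\<^sub>0 \<in> H" "h\<^sub>0 0 \<in> vertices G"
    and near: "\<And>h x y. \<lbrakk>h \<in> H; y \<in> nbrs G (h x)\<rbrakk>
        \<Longrightarrow> \<exists>h'\<in>H. \<exists>x'. y = h' x' \<and> (\<forall>i. \<bar>x' $ i - x $ i\<bar> \<le> 1)"
  shows "poly_exhaustion G (\<lambda>n. \<Union>h\<in>H. h ` int_cube n)"
  unfolding poly_exhaustion_def
proof (intro conjI allI ballI)
  fix n
  have mono: "(int_cube n :: (int ^ 'n) set) \<subseteq> int_cube (Suc n)"
    by (auto simp: int_cube_def) (metis add_increasing zero_le_one)
  show "(\<Union>h\<in>H. h ` int_cube n) \<subseteq> (\<Union>h\<in>H. h ` int_cube (Suc n))"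
    using mono by blast
  fix v assume "v \<in> (\<Union>h\<in>H. h ` int_cube n)"
  then obtain h x where h: "h \<in> H" and x: "x \<in> int_cube n" and v: "v = h x" by blast
  show "nbrs G v \<subseteq> (\<Union>h\<in>H. h ` int_cube (Suc n))"
  proof
    fix y assume "y \<in> nbrs G v"
    then obtain h' x' where h': "h' \<in> H" "y = h' x'" and x': "\<And>i. \<bar>x' $ i - x $ i\<bar> \<le> 1"
      using near[OF h] v by metis
    have "\<bar>x' $ i\<bar> \<le> int (Suc n)" for i
    proof -
      have "\<bar>x $ i\<bar> \<le> int n" using x by (simp add: int_cube_def)
      with x'[of i] show ?thesis by linarith
    qed
    then show "y \<in> (\<Union>h\<in>H. h ` int_cube (Suc n))"
      using h' by (auto simp: int_cube_def)
  qed
next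
  have "0 \<in> int_cube 0" by (simp add: int_cube_def)
  then show "(\<Union>h\<in>H. h ` int_cube 0) \<inter> vertices G \<noteq> {}" using origin by blast
next
  have "finite (\<Union>h\<in>H. h ` int_cube n) \<and> card (\<Union>h\<in>H. h ` int_cube n) \<le> card H * (2 * n + 1) ^ CARD('n)" for n
  proof
    show "finite (\<Union>h\<in>H. h ` int_cube n)" using H card_int_cube by blast
    have "card (\<Union>h\<in>H. h ` int_cube n) \<le> (\<Sum>h\<in>H. card (h ` int_cube n))" using H by (rule card_UN_le)
    also have "\<dots> \<le> (\<Sum>h\<in>H. (2 * n + 1) ^ CARD('n))"
      by (intro sum_mono order_trans[OF card_image_le card_int_cube(2)] card_int_cube)
    finally show "card (\<Union>h\<in>H. h ` int_cube n) \<le> card H * (2 * n + 1) ^ CARD('n)" by simp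
  qed
  then show "\<exists>K j. \<forall>n. finite (\<Union>h\<in>H. h ` int_cube n) \<and> card (\<Union>h\<in>H. h ` int_cube n) \<le> K * (2 * n + 1) ^ j"
    by blast
qed

lemma edges_clique_partition:
  assumes "regular_graph G d"
  shows "clique_partition G (edges G) 2 d"
proof -
  have sym: "sym (oriented_edges G)" and irr: "\<And>x. (x, x) \<notin> oriented_edges G"
    and deg: "\<And>x. x \<in> vertices G \<Longrightarrow> finite (nbrs G x) \<and> card (nbrs G x) = d"
    using assms by (auto simp: regular_graph_def irrefl_def)
  have at: "{e \<in> edges G. x \<in> e} = (\<lambda>y. {x, y}) ` nbrs G x" for x
    using sym by (auto simp: edges_def nbrs_def image_iff insert_commute dest: symD)
  have inj: "inj_on (\<lambda>y. {x, y}) (nbrs G x)" for x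
    by (auto simp: inj_on_def doubleton_eq_iff)
  show ?thesis
  proof
    fix c assume "c \<in> edges G"
    then obtain x y where c: "c = {x, y}" "(x, y) \<in> oriented_edges G" by (auto simp: edges_def)
    moreover have "x \<noteq> y" using irr c by auto
    ultimately show "c \<subseteq> vertices G" "finite c" "card c = 2"
      by (auto simp: oriented_edges_def)
  next
    fix x assume "x \<in> vertices G"
    then show "finite {c \<in> edges G. x \<in> c}" "card {c \<in> edges G. x \<in> c} = d"
      by (simp_all add: at card_image inj deg)
  next
    fix x y
    show "(x, y) \<in> oriented_edges G \<longleftrightarrow> x \<noteq> y \<and> (\<exists>c\<in>edges G. x \<in> c \<and> y \<in> c)"
      using irr sym by (auto simp: edges_def dest: symD)
  next
    fix c c' x y
    assume "c \<in> edges G" "c' \<in> edges G" "x \<noteq> y" "x \<in> c" "y \<in> c" "x \<in> c'" "y \<in> c'"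
    then show "c = c'" by (auto simp: edges_def)
  qed
qed

text \<open>In a bipartite graph the function that is \<open>1\<close> on one class and \<open>-1\<close> on the other has zero sum over
  every edge, so the partition into single edges is already optimal.\<close>

lemma bipartite_laplacian_norm:
  assumes reg: "regular_graph G d" and d: "0 < d" and exh: "poly_exhaustion G F"
    and alt: "\<And>x y. (x, y) \<in> oriented_edges G \<Longrightarrow> even_class y \<longleftrightarrow> \<not> even_class x"
  shows "l2_bounded G (edge_laplacian G)" "l2_onorm G (edge_laplacian G) = 2 * real d"
proof -
  interpret clique_partition G "edges G" 2 d by (rule edges_clique_partition[OF reg])
  define u :: "'a \<Rightarrow> complex" where "u x = (if even_class x then 1 else -1)" for x
  have "(\<Sum>x\<in>c. u x) = 0" if "c \<in> edges G" for c
  proof -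
    from that obtain x y where c: "c = {x, y}" and xy: "(x, y) \<in> oriented_edges G"
      by (auto simp: edges_def)
    have "x \<noteq> y" using alt[OF xy] by auto
    then show ?thesis using alt[OF xy] by (simp add: c u_def)
  qed
  moreover have "cmod (u x) = 1" for x by (simp add: u_def)
  ultimately show "l2_bounded G (edge_laplacian G)" "l2_onorm G (edge_laplacian G) = 2 * real d"
    using laplacian_norm[OF exh, of u] d by simp_all
qed

text \<open>Two translates of \<open>S\<close> can share an edge only if some difference of elements of \<open>S\<close> occurs twice.
  Hence a Sidon set \<open>S\<close>, one with all differences distinct, yields a partition by its translates, and
  each vertex \<open>x\<close> lies in exactly the translates by \<open>x - s\<close> with \<open>s \<in> S\<close>.\<close>

lemma translate_clique_partition:
  fixes S :: "'v::ab_group_add set"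
  assumes fin: "finite S"
    and closed: "\<And>x s. \<lbrakk>x \<in> vertices G; s \<in> S\<rbrakk> \<Longrightarrow> x + s \<in> vertices G \<and> x - s \<in> vertices G"
    and adj: "\<And>x y. \<lbrakk>x \<in> vertices G; y \<in> vertices G\<rbrakk>
        \<Longrightarrow> adjacent G x y \<longleftrightarrow> (\<exists>s\<in>S. \<exists>t\<in>S. s \<noteq> t \<and> y - x = t - s)"
    and sidon: "\<And>s t s' t'. \<lbrakk>s \<in> S; t \<in> S; s' \<in> S; t' \<in> S; s \<noteq> t; t - s = t' - s'\<rbrakk> \<Longrightarrow> s = s'"
  shows "clique_partition G ((\<lambda>x. (+) x ` S) ` vertices G) (card S) (card S)"
proof
  fix x assume x: "x \<in> vertices G"
  have at: "{c \<in> (\<lambda>x. (+) x ` S) ` vertices G. x \<in> c} = (\<lambda>s. (+) (x - s) ` S) ` S"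
  proof
    show "{c \<in> (\<lambda>x. (+) x ` S) ` vertices G. x \<in> c} \<subseteq> (\<lambda>s. (+) (x - s) ` S) ` S"
      by force
    show "(\<lambda>s. (+) (x - s) ` S) ` S \<subseteq> {c \<in> (\<lambda>x. (+) x ` S) ` vertices G. x \<in> c}"
      using closed[OF x] by (auto simp: image_iff intro: bexI)
  qed
  \<comment> \<open>Two translates through \<open>x\<close> that agree as sets would give the progression \<open>s, s', t\<close> in \<open>S\<close>.\<close>
  have "inj_on (\<lambda>s. (+) (x - s) ` S) S"
  proof (rule inj_onI)
    fix s s' assume s: "s \<in> S" "s' \<in> S" and eq: "(+) (x - s) ` S = (+) (x - s') ` S"
    have "(x - s) + s' \<in> (+) (x - s') ` S" using s eq by blast
    then obtain t where "t \<in> S" "(x - s) + s' = (x - s') + t" by blast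
    moreover from this(2) have "s' - s = t - s'" by (simp add: algebra_simps)
    ultimately show "s = s'" using sidon[of s s' s' t] s by blast
  qed
  then show "card {c \<in> (\<lambda>x. (+) x ` S) ` vertices G. x \<in> c} = card S"
    unfolding at by (rule card_image)
  show "finite {c \<in> (\<lambda>x. (+) x ` S) ` vertices G. x \<in> c}"
    unfolding at using fin by simp
next
  fix x y
  show "(x, y) \<in> oriented_edges G \<longleftrightarrow>
      x \<noteq> y \<and> (\<exists>c\<in>(\<lambda>x. (+) x ` S) ` vertices G. x \<in> c \<and> y \<in> c)" (is "?L \<longleftrightarrow> ?R")
  proof
    assume ?L
    then have x: "x \<in> vertices G" and "y \<in> vertices G" "adjacent G x y"
      by (auto simp: oriented_edges_def)
    then obtain s t where st: "s \<in> S" "t \<in> S" "s \<noteq> t" "y - x = t - s" using adj by blast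
    have "x = (x - s) + s" "y = (x - s) + t" using st(4) by (simp_all add: algebra_simps)
    moreover have "x - s \<in> vertices G" using closed x st by blast
    moreover have "x \<noteq> y" using st by auto
    ultimately show ?R using st by blast
  next
    assume ?R
    then obtain z s t where z: "z \<in> vertices G" "x = z + s" "y = z + t" "s \<in> S" "t \<in> S" "x \<noteq> y"
      by blast
    moreover have "s \<noteq> t" "y - x = t - s" using z by auto
    ultimately show ?L using adj[of x y] closed by (auto simp: oriented_edges_def)
  qed
next
  fix c c' x y
  assume "c \<in> (\<lambda>x. (+) x ` S) ` vertices G" "c' \<in> (\<lambda>x. (+) x ` S) ` vertices G"
    and xy: "x \<noteq> y" "x \<in> c" "y \<in> c" "x \<in> c'" "y \<in> c'"
  then obtain z z' where c: "c = (+) z ` S" "c' = (+) z' ` S" by blast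
  obtain s t where st: "s \<in> S" "t \<in> S" "x = z + s" "y = z + t" using xy c by blast
  obtain s' t' where st': "s' \<in> S" "t' \<in> S" "x = z' + s'" "y = z' + t'" using xy c by blast
  have "t - s = t' - s'" using st st' by (metis add_diff_cancel_left)
  moreover have "s \<noteq> t" using xy st by auto
  ultimately have "s = s'" using sidon st st' by blast
  then show "c = c'" using st st' c by auto
qed (use closed fin in \<open>auto simp: card_image\<close>)



text \<open>A primitive cube root of unity: \<open>1, \<omega>, \<omega>\<^sup>2\<close> are three unimodular numbers with sum zero, one
  for each vertex of a triangle.\<close>

definition \<omega> :: complex where "\<omega> = Complex (- 1 / 2) (sqrt 3 / 2)"

lemma omega_sum: "1 + \<omega> + \<omega>\<^sup>2 = 0"
  by (simp add: \<omega>_def complex_eq_iff power2_eq_square)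

lemma cmod_omega: "cmod \<omega> = 1"
  by (simp add: \<omega>_def cmod_def power2_eq_square)

section \<open>Bipartite lattices: integer and diamond\<close>

lemma integer_lattice_nbrs:
  "nbrs integer_lattice x = range (\<lambda>j. x + axis j 1) \<union> range (\<lambda>j. x - axis j 1)"
  by (auto simp: nbrs_def oriented_edges_def integer_lattice_def)

lemma integer_lattice_regular: "regular_graph (integer_lattice :: (int ^ 'n) graph) (2 * CARD('n))"
  unfolding regular_graph_def
proof (intro conjI ballI)
  show "sym (oriented_edges (integer_lattice :: (int ^ 'n) graph))"
    by (rule symI, simp add: oriented_edges_def integer_lattice_def)
      (metis add_diff_cancel diff_add_cancel)
  show "irrefl (oriented_edges (integer_lattice :: (int ^ 'n) graph))"
    by (auto simp: irrefl_def oriented_edges_def integer_lattice_def axis_eq_0_iff)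
  fix x :: "int ^ 'n"
  have disj: "range (\<lambda>j. x + axis j 1) \<inter> range (\<lambda>j. x - axis j 1) = {}"
  proof -
    have "x + axis j 1 \<noteq> x - axis i 1" for i j
    proof
      assume "x + axis j 1 = x - axis i 1"
      then have "(x + axis j 1) $ j = (x - axis i 1) $ j" by simp
      then show False by (simp add: axis_def split: if_splits)
    qed
    then show ?thesis by blast
  qed
  have "inj (\<lambda>j. x + axis j 1)" "inj (\<lambda>j. x - axis j 1)"
    by (auto simp: inj_on_def axis_eq_axis)
  then show "card (nbrs integer_lattice x) = 2 * CARD('n)"
    unfolding integer_lattice_nbrs using disj by (subst card_Un_disjoint) (auto simp: card_image)
  show "finite (nbrs integer_lattice x)" by (simp add: integer_lattice_nbrs)
qed

lemma axis_bound: "\<bar>axis j (1::int) $ i\<bar> \<le> 1"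
  by (simp add: axis_def)

lemma integer_lattice_exhaustion:
  "poly_exhaustion (integer_lattice :: (int ^ 'n) graph) (\<lambda>n. \<Union>h\<in>{\<lambda>x. x}. h ` int_cube n)"
  by (rule poly_exhaustion_cells)
    (auto simp: integer_lattice_nbrs axis_bound, auto simp: integer_lattice_def)

lemma integer_lattice_norm:
  "l2_bounded (integer_lattice :: (int ^ 'n) graph) (edge_laplacian integer_lattice)"
  "l2_onorm (integer_lattice :: (int ^ 'n) graph) (edge_laplacian integer_lattice) = 4 * real CARD('n)"
proof -
  have ax: "(\<Sum>i\<in>UNIV. axis j (1::int) $ i) = 1" for j :: 'n
    by (simp add: axis_def)
  have alt: "even (\<Sum>i\<in>UNIV. y $ i) \<longleftrightarrow> odd (\<Sum>i\<in>UNIV. x $ i)"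
    if "(x, y) \<in> oriented_edges integer_lattice" for x y :: "int ^ 'n"
    using that by (auto simp: oriented_edges_def integer_lattice_def sum.distrib sum_subtractf ax)
  show "l2_bounded (integer_lattice :: (int ^ 'n) graph) (edge_laplacian integer_lattice)"
    "l2_onorm (integer_lattice :: (int ^ 'n) graph) (edge_laplacian integer_lattice) = 4 * real CARD('n)"
    using bipartite_laplacian_norm[OF integer_lattice_regular _ integer_lattice_exhaustion alt]
    by simp_all
qed

lemma diamond_nbrs:
  "nbrs diamond_lattice (DA x) = insert (DB x) (range (\<lambda>j. DB (x - axis j 1)))"
  "nbrs diamond_lattice (DB x) = insert (DA x) (range (\<lambda>j. DA (x + axis j 1)))"
  by (auto simp: nbrs_def oriented_edges_def diamond_lattice_def symclp_def diamond_bond.simps)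

lemma diamond_regular: "regular_graph diamond_lattice 4"
  unfolding regular_graph_def
proof (intro conjI ballI)
  show "sym (oriented_edges diamond_lattice)"
    by (rule symI) (auto simp: oriented_edges_def diamond_lattice_def symclp_def)
  show "irrefl (oriented_edges diamond_lattice)"
    by (auto simp: irrefl_def oriented_edges_def diamond_lattice_def symclp_def diamond_bond.simps)
  fix x
  show "finite (nbrs diamond_lattice x)" by (cases x) (simp_all add: diamond_nbrs)
  have "inj (\<lambda>j::3. DB (z - axis j 1))" "inj (\<lambda>j::3. DA (z + axis j 1))" for z
    by (auto simp: inj_on_def axis_eq_axis)
  moreover have "DB z \<notin> range (\<lambda>j::3. DB (z - axis j 1))" "DA z \<notin> range (\<lambda>j::3. DA (z + axis j 1))" for z
    by (auto simp: axis_eq_0_iff)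
  ultimately show "card (nbrs diamond_lattice x) = 4"
    by (cases x) (simp_all add: diamond_nbrs card_image)
qed

lemma diamond_norm:
  "l2_bounded diamond_lattice (edge_laplacian diamond_lattice)"
  "l2_onorm diamond_lattice (edge_laplacian diamond_lattice) = 8"
proof -
  have exh: "poly_exhaustion diamond_lattice (\<lambda>n. \<Union>h\<in>{DA, DB}. h ` int_cube n)"
    by (rule poly_exhaustion_cells[of _ DA])
      (auto simp: diamond_nbrs axis_bound, auto simp: diamond_lattice_def)
  have alt: "is_DA y \<longleftrightarrow> \<not> is_DA x" if "(x, y) \<in> oriented_edges diamond_lattice" and
    "is_DA = (\<lambda>v. \<exists>z. v = DA z)" for x y is_DA
    using that by (auto simp: oriented_edges_def diamond_lattice_def symclp_def diamond_bond.simps)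
  show "l2_bounded diamond_lattice (edge_laplacian diamond_lattice)"
    "l2_onorm diamond_lattice (edge_laplacian diamond_lattice) = 8"
    using bipartite_laplacian_norm[OF diamond_regular _ exh alt[OF _ refl]] by simp_all
qed

section \<open>Lattices of triangles: triangular and Kagome\<close>

lemma axis_neq: "axis 1 (1::int) \<noteq> (axis 2 1 :: int ^ 2)" "axis (i::2) (1::int) \<noteq> 0"
  by (auto simp: axis_eq_axis axis_eq_0_iff)

text \<open>The triangles \<open>x, x + e\<^sub>1, x + e\<^sub>1 + e\<^sub>2\<close> of one orientation already contain every edge exactly once,
  so \<open>k = m = 3\<close>. The eigenfunction is the character \<open>\<omega> powi (x\<^sub>1 + x\<^sub>2)\<close>, which takes the values of
  \<open>1, \<omega>, \<omega>\<^sup>2\<close> up to a common factor on each of these triangles.\<close>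

lemma triangular_norm:
  "regular_graph triangular_lattice 6"
  "l2_bounded triangular_lattice (edge_laplacian triangular_lattice)"
  "l2_onorm triangular_lattice (edge_laplacian triangular_lattice) = 9"
proof -
  let ?G = triangular_lattice
  let ?S = "{0, axis 1 1, axis 1 1 + axis 2 1} :: (int ^ 2) set"
  note coord = vec_eq_iff forall_2 axis_def
  have S: "card ?S = 3" by (simp add: coord)
  have "clique_partition ?G ((\<lambda>x. (+) x ` ?S) ` vertices ?G) (card ?S) (card ?S)"
  proof (rule translate_clique_partition)
    show "adjacent ?G x y \<longleftrightarrow> (\<exists>s\<in>?S. \<exists>t\<in>?S. s \<noteq> t \<and> y - x = t - s)" for x y
      by (simp add: triangular_lattice_def) (simp add: coord, presburger)
    show "s = s'" if "s \<in> ?S" "t \<in> ?S" "s' \<in> ?S" "t' \<in> ?S" "s \<noteq> t" "t - s = t' - s'" for s t s' t'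
      using that by (auto simp: coord)
  qed (simp_all add: triangular_lattice_def)
  then interpret clique_partition ?G "(\<lambda>x. (+) x ` ?S) ` vertices ?G" 3 3
    unfolding S .
  have exh: "poly_exhaustion ?G (\<lambda>n. \<Union>h\<in>{\<lambda>x. x}. h ` int_cube n)"
    by (rule poly_exhaustion_cells)
      (auto simp: nbrs_def oriented_edges_def triangular_lattice_def forall_2 axis_def)
  define u where "u x = \<omega> powi (x $ 1 + x $ 2)" for x :: "int ^ 2"
  have unit: "cmod (u x) = 1" for x by (simp add: u_def norm_power_int cmod_omega)
  have balanced: "(\<Sum>x\<in>c. u x) = 0" if c: "c \<in> (\<lambda>x. (+) x ` ?S) ` vertices ?G" for c
  proof -
    obtain x where c: "c = (+) x ` ?S" using c by blast
    have nz: "\<omega> \<noteq> 0" using cmod_omega by auto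
    have "(\<Sum>x\<in>c. u x) = (\<Sum>s\<in>?S. u (x + s))"
      unfolding c by (subst sum.reindex) (auto simp: inj_on_def)
    also have "\<dots> = u x + u (x + axis 1 1) + u (x + (axis 1 1 + axis 2 1))"
      using S by (simp add: card_insert_if split: if_splits)
    also have "\<dots> = \<omega> powi (x $ 1 + x $ 2) * (1 + \<omega> + \<omega>\<^sup>2)"
      using nz by (simp add: u_def axis_def power_int_add algebra_simps power2_eq_square)
    finally show ?thesis by (simp add: omega_sum)
  qed
  show "regular_graph ?G 6" "l2_bounded ?G (edge_laplacian ?G)" "l2_onorm ?G (edge_laplacian ?G) = 9"
    using laplacian_norm[OF exh unit balanced] by simp_all
qed

lemma kagome_nbrs:
  "nbrs kagome_lattice (KA x) = {KB x, KB (x - axis 1 1), KC x, KC (x - axis 2 1)}"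
  "nbrs kagome_lattice (KB x) = {KA x, KA (x + axis 1 1), KC x, KC (x - axis 2 1 + axis 1 1)}"
  "nbrs kagome_lattice (KC x) = {KA x, KA (x + axis 2 1), KB x, KB (x + axis 2 1 - axis 1 1)}"
  by (auto simp: nbrs_def oriented_edges_def kagome_lattice_def symclp_def kagome_bond.simps algebra_simps)

lemma kagome_exhaustion: "poly_exhaustion kagome_lattice (\<lambda>n. \<Union>h\<in>{KA, KB, KC}. h ` int_cube n)"
proof (rule poly_exhaustion_cells[of _ KA])
  fix h :: "int ^ 2 \<Rightarrow> kagome_vertex" and x y
  assume h: "h \<in> {KA, KB, KC}" and y: "y \<in> nbrs kagome_lattice (h x)"
  let ?D = "{0, axis 1 1, - axis 1 1, axis 2 1, - axis 2 1, axis 2 1 - axis 1 1, axis 1 1 - axis 2 1} :: (int ^ 2) set"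
  have "\<exists>h'\<in>{KA, KB, KC}. y \<in> (\<lambda>d. h' (x + d)) ` ?D"
    using h y by (elim insertE emptyE; simp add: kagome_nbrs algebra_simps; blast)
  then obtain h' d where h': "h' \<in> {KA, KB, KC}" "y = h' (x + d)" and d: "d \<in> ?D"
    by blast
  have "\<bar>d $ i\<bar> \<le> 1" for i
    using d by (elim insertE emptyE; simp add: axis_def)
  with h' show "\<exists>h'\<in>{KA, KB, KC}. \<exists>x'. y = h' x' \<and> (\<forall>i. \<bar>x' $ i - x $ i\<bar> \<le> 1)"
    by (intro bexI[of _ h'] exI[of _ "x + d"]) auto
qed (auto simp: kagome_lattice_def)

text \<open>Here both kinds of triangles are needed, and each vertex lies in one of either kind: \<open>k = 3\<close>,
  \<open>m = 2\<close>. Every triangle has one vertex of each type, so the eigenfunction depends on the type only.\<close>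

lemma kagome_norm:
  "regular_graph kagome_lattice 4"
  "l2_bounded kagome_lattice (edge_laplacian kagome_lattice)"
  "l2_onorm kagome_lattice (edge_laplacian kagome_lattice) = 6"
proof -
  let ?G = kagome_lattice
  let ?e1 = "axis 1 1 :: int ^ 2" and ?e2 = "axis 2 1 :: int ^ 2"
  define up where "up x = {KA x, KB x, KC x}" for x
  define down where "down x = {KA x, KB (x - ?e1), KC (x - ?e2)}" for x
  note neq = axis_neq axis_neq(1)[symmetric]
  have up_down: "up x \<noteq> down y" for x y
  proof
    assume "up x = down y"
    then have "KA x \<in> down y" "KB x \<in> down y" by (auto simp: up_def)
    then show False by (simp add: down_def neq)
  qed
  have at: "{c \<in> range up \<union> range down. KA x \<in> c} = {up x, down x}"
    "{c \<in> range up \<union> range down. KB x \<in> c} = {up x, down (x + ?e1)}"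
    "{c \<in> range up \<union> range down. KC x \<in> c} = {up x, down (x + ?e2)}" for x
    by (auto simp: up_def down_def)
  interpret clique_partition ?G "range up \<union> range down" 3 2
  proof
    fix x
    show "finite {c \<in> range up \<union> range down. x \<in> c}" "card {c \<in> range up \<union> range down. x \<in> c} = 2"
      by (cases x; simp only: at; simp add: up_down)+
  next
    have bond: "adjacent ?G a b \<longleftrightarrow> kagome_bond a b \<or> kagome_bond b a" for a b
      by (simp add: kagome_lattice_def symclp_def)
    have bond_clique: "a \<noteq> b \<and> (\<exists>c\<in>range up \<union> range down. a \<in> c \<and> b \<in> c)" if "kagome_bond a b" for a b
      using that
    proof cases
      case (2 x) then show ?thesis by (auto simp: down_def)
    next
      case (4 x) then show ?thesis by (auto simp: down_def)
    next
      case (6 x)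
      then have "a \<in> down (x + ?e1)" "b \<in> down (x + ?e1)" by (simp_all add: down_def algebra_simps)
      with 6 show ?thesis by blast
    qed (auto simp: up_def)
    have clique_bond: "adjacent ?G a b" if ab: "a \<noteq> b" and c: "c \<in> range up \<union> range down" "a \<in> c" "b \<in> c" for a b c
    proof -
      have "kagome_bond (KB (x - ?e1)) (KC (x - ?e2))" for x
        using kagome_bond.intros(6)[of "x - ?e1"] by (simp add: algebra_simps)
      then show ?thesis using ab c by (auto simp: up_def down_def bond intro: kagome_bond.intros)
    qed
    show "(x, y) \<in> oriented_edges ?G \<longleftrightarrow> x \<noteq> y \<and> (\<exists>c\<in>range up \<union> range down. x \<in> c \<and> y \<in> c)" for x y
    proof -
      have "(x, y) \<in> oriented_edges ?G \<longleftrightarrow> adjacent ?G x y"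
        by (simp add: oriented_edges_def kagome_lattice_def)
      moreover have "x \<noteq> y \<and> (\<exists>c\<in>range up \<union> range down. x \<in> c \<and> y \<in> c)" if "adjacent ?G x y"
        using that bond_clique[of x y] bond_clique[of y x] unfolding bond by blast
      ultimately show ?thesis using clique_bond[of x y] by blast
    qed
  next
    fix c c' x y
    assume c: "c \<in> range up \<union> range down" "c' \<in> range up \<union> range down" 
      and xy: "x \<noteq> y" "x \<in> c" "y \<in> c" "x \<in> c'" "y \<in> c'"
    have meet: "up z \<inter> down z = {KA z}" "up z \<inter> down (z + ?e1) = {KB z}" "up z \<inter> down (z + ?e2) = {KC z}" for z
      by (simp_all add: up_def down_def neq eq_diff_eq)
    have "c \<in> {c \<in> range up \<union> range down. x \<in> c}" "c' \<in> {c \<in> range up \<union> range down. x \<in> c}"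
      using c xy by simp_all
    note mem = this
    have two: "c \<inter> c' = {x}" if "c \<in> {p, q}" "c' \<in> {p, q}" "p \<inter> q = {x}" "c \<noteq> c'" for p q
      using that by blast
    show "c = c'"
    proof (rule ccontr)
      assume "c \<noteq> c'"
      then have "c \<inter> c' = {x}"
      proof (cases x)
        case (KA z)
        show ?thesis by (rule two[OF mem[unfolded KA at]]) (use meet KA \<open>c \<noteq> c'\<close> in simp_all)
      next
        case (KB z)
        show ?thesis by (rule two[OF mem[unfolded KB at]]) (use meet KB \<open>c \<noteq> c'\<close> in simp_all)
      next
        case (KC z)
        show ?thesis by (rule two[OF mem[unfolded KC at]]) (use meet KC \<open>c \<noteq> c'\<close> in simp_all)
      qed
      moreover have "y \<in> c \<inter> c'" using xy by (intro IntI)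
      ultimately show False using xy(1) by simp
    qed
  qed (auto simp: kagome_lattice_def up_def down_def)
  define u where "u v = (case v of KA _ \<Rightarrow> 1 | KB _ \<Rightarrow> \<omega> | KC _ \<Rightarrow> \<omega>\<^sup>2)" for v
  have unit: "cmod (u x) = 1" for x
    by (cases x) (simp_all add: u_def cmod_omega norm_power)
  have balanced: "(\<Sum>x\<in>c. u x) = 0" if "c \<in> range up \<union> range down" for c
    using that omega_sum by (auto simp: up_def down_def u_def add.assoc)
  show "regular_graph ?G 4" "l2_bounded ?G (edge_laplacian ?G)" "l2_onorm ?G (edge_laplacian ?G) = 6"
    using laplacian_norm[OF kagome_exhaustion unit balanced] by simp_all
qed

section \<open>Lattices of half-integer points: body-centered and face-centered cubic\<close>

text \<open>Both lattices live on half-integer points, so doubling the coordinates turns the vertex conditions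
  into parities and the distance conditions into equations between sums of integer squares.\<close>

definition half :: "int ^ 3 \<Rightarrow> real ^ 3" where
  "half z = (\<chi> i. of_int (z $ i) / 2)"

lemma half_add: "half (z + w) = half z + half w" and half_diff: "half (z - w) = half z - half w"
  by (simp_all add: half_def vec_eq_iff add_divide_distrib diff_divide_distrib)

lemma inj_half: "inj half"
  by (auto simp: inj_def half_def vec_eq_iff)

lemma half_eq_iff: "half z = half w \<longleftrightarrow> z = w"
  using inj_half by (auto simp: inj_def)

lemma dist_half:
  assumes "0 \<le> r"
  shows "dist (half z) (half w) = r
    \<longleftrightarrow> real_of_int ((w $ 1 - z $ 1)\<^sup>2 + (w $ 2 - z $ 2)\<^sup>2 + (w $ 3 - z $ 3)\<^sup>2) = 4 * r\<^sup>2"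
proof -
  have "(dist (half z) (half w))\<^sup>2
      = real_of_int ((w $ 1 - z $ 1)\<^sup>2 + (w $ 2 - z $ 2)\<^sup>2 + (w $ 3 - z $ 3)\<^sup>2) / 4"
  proof -
    have sq: "(of_int a / 2 - of_int b / 2)\<^sup>2 = (real_of_int ((b - a)\<^sup>2)) / 4" for a b
      by (simp add: power2_eq_square field_simps)
    have "(dist (half z) (half w))\<^sup>2 = (\<Sum>i\<in>UNIV. (dist (half z $ i) (half w $ i))\<^sup>2)"
      by (simp add: dist_vec_def L2_set_def sum_nonneg)
    then show ?thesis
      by (simp only: sum_3 half_def vec_lambda_beta dist_real_def power2_abs sq of_int_add add_divide_distrib)
  qed
  moreover have "dist (half z) (half w) = r \<longleftrightarrow> (dist (half z) (half w))\<^sup>2 = r\<^sup>2"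
    using assms by simp
  moreover have "N / 4 = r\<^sup>2 \<longleftrightarrow> N = 4 * r\<^sup>2" for N :: real by auto
  ultimately show ?thesis by (simp only:)
qed

lemma integer_points_half: "integer_points = half ` {z. \<forall>i. even (z $ i)}"
proof (intro equalityI subsetI)
  fix x assume "x \<in> integer_points"
  then have "\<exists>a. \<forall>i. x $ i = of_int (a i)"
    unfolding integer_points_def Ints_def by (auto intro!: choice)
  then obtain a where "\<And>i. x $ i = of_int (a i)" by blast
  then have "x = half (\<chi> i. 2 * a i)" by (simp add: half_def vec_eq_iff)
  then show "x \<in> half ` {z. \<forall>i. even (z $ i)}" by force
next
  fix x assume "x \<in> half ` {z. \<forall>i. even (z $ i)}"
  then obtain z where z: "\<forall>i. even (z $ i)" "x = half z" by blast
  have "real_of_int (z $ i) / 2 \<in> \<int>" for i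
    using z(1)[THEN spec, of i] by (elim evenE) simp
  then show "x \<in> integer_points"
    by (simp add: integer_points_def half_def z(2))
qed

lemma integer_points_shift:
  "(\<lambda>z. z + half w) ` integer_points = half ` {z. \<forall>i. even (z $ i - w $ i)}"
proof (intro equalityI subsetI)
  fix x assume "x \<in> (\<lambda>z. z + half w) ` integer_points"
  then obtain z where "\<forall>i. even (z $ i)" "x = half (z + w)"
    by (auto simp: integer_points_half half_add)
  then show "x \<in> half ` {z. \<forall>i. even (z $ i - w $ i)}" by force
next
  fix x assume "x \<in> half ` {z. \<forall>i. even (z $ i - w $ i)}"
  then obtain z where z: "\<forall>i. even (z $ i - w $ i)" "x = half z" by blast
  then have "x = half (z - w) + half w" by (simp add: half_diff)
  with z(1) show "x \<in> (\<lambda>z. z + half w) ` integer_points"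
    by (auto simp: integer_points_half)
qed

lemma vector_half: "vector [of_int a / 2, of_int b / 2, of_int c / 2] = half (vector [a, b, c])"
  by (simp add: half_def vec_eq_iff forall_3)

text \<open>All three doubled coordinates have the same parity: even at lattice points, odd at body centers.\<close>

lemma bcc_vertices:
  "vertices bcc_lattice = half ` {z. (even (z $ 1) \<longleftrightarrow> even (z $ 2)) \<and> (even (z $ 2) \<longleftrightarrow> even (z $ 3))}"
proof -
  have "vector [1/2, 1/2, 1/2] = half (vector [1, 1, 1])"
    using vector_half[of 1 1 1] by simp
  then have "vertices bcc_lattice
      = half ` ({z. \<forall>i. even (z $ i)} \<union> {z. \<forall>i. even (z $ i - (vector [1, 1, 1] :: int ^ 3) $ i)})"
    by (simp add: bcc_lattice_def integer_points_shift) (simp add: integer_points_half image_Un)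
  also have "{z. \<forall>i. even (z $ i)} \<union> {z. \<forall>i. even (z $ i - (vector [1, 1, 1] :: int ^ 3) $ i)}
      = {z. (even (z $ 1) \<longleftrightarrow> even (z $ 2)) \<and> (even (z $ 2) \<longleftrightarrow> even (z $ 3))}"
    by (auto simp: forall_3)
  finally show ?thesis .
qed

text \<open>Lattice points have three even doubled coordinates and face centers exactly one, which is the
  condition that the sum is even.\<close>

lemma fcc_vertices:
  "vertices fcc_lattice = half ` {z. even (z $ 1 + z $ 2 + z $ 3)}"
proof -
  have v: "vector [0, 1/2, 1/2] = half (vector [0, 1, 1])" "vector [1/2, 0, 1/2] = half (vector [1, 0, 1])"
    "vector [1/2, 1/2, 0] = half (vector [1, 1, 0])"
    using vector_half[of 0 1 1] vector_half[of 1 0 1] vector_half[of 1 1 0] by simp_all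
  have "vertices fcc_lattice = half ` ({z. \<forall>i. even (z $ i)} \<union>
      (\<Union>w\<in>{vector [0, 1, 1], vector [1, 0, 1], vector [1, 1, 0]}. {z. \<forall>i. even (z $ i - (w :: int ^ 3) $ i)}))"
    by (simp add: fcc_lattice_def v integer_points_shift) (simp add: integer_points_half image_Un Un_assoc)
  also have "{z. \<forall>i. even (z $ i)} \<union>
      (\<Union>w\<in>{vector [0, 1, 1], vector [1, 0, 1], vector [1, 1, 0]}. {z. \<forall>i. even (z $ i - (w :: int ^ 3) $ i)})
      = {z. even (z $ 1 + z $ 2 + z $ 3)}"
    by (auto simp: forall_3)
  finally show ?thesis .
qed

lemma int_squares_sum_le_three:
  fixes a b c :: int
  assumes "a\<^sup>2 + b\<^sup>2 + c\<^sup>2 \<le> 3"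
  shows "a \<in> {-1, 0, 1}" "b \<in> {-1, 0, 1}" "c \<in> {-1, 0, 1}"
proof -
  have "x \<in> {-1, 0, 1}" if "x\<^sup>2 \<le> 3" for x :: int
  proof -
    have "\<not> 2 \<le> \<bar>x\<bar>"
    proof
      assume "2 \<le> \<bar>x\<bar>"
      then have "2\<^sup>2 \<le> \<bar>x\<bar>\<^sup>2" by (intro power_mono) auto
      with that show False by simp
    qed
    then show ?thesis by auto
  qed
  moreover have "0 \<le> a\<^sup>2" "0 \<le> b\<^sup>2" "0 \<le> c\<^sup>2" by simp_all
  then have "a\<^sup>2 \<le> 3" "b\<^sup>2 \<le> 3" "c\<^sup>2 \<le> 3" using assms by linarith+
  ultimately show "a \<in> {-1, 0, 1}" "b \<in> {-1, 0, 1}" "c \<in> {-1, 0, 1}" by blast+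
qed

text \<open>Three is a sum of three integer squares only as \<open>1 + 1 + 1\<close>.\<close>

lemma bcc_adjacent:
  "adjacent bcc_lattice (half z) (half w) \<longleftrightarrow> (\<forall>i. w $ i - z $ i \<in> {-1, 1})"
proof -
  have "adjacent bcc_lattice (half z) (half w)
      \<longleftrightarrow> (w $ 1 - z $ 1)\<^sup>2 + (w $ 2 - z $ 2)\<^sup>2 + (w $ 3 - z $ 3)\<^sup>2 = 3"
  proof -
    have "4 * (sqrt 3 / 2)\<^sup>2 = real_of_int 3" by (simp add: power_divide)
    then show ?thesis
      using dist_half[of "sqrt 3 / 2" z w] by (simp only: bcc_lattice_def graph.simps of_int_eq_iff) simp
  qed
  also have "\<dots> \<longleftrightarrow> (\<forall>i. w $ i - z $ i \<in> {-1, 1})"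
    unfolding forall_3
  proof
    assume eq: "(w $ 1 - z $ 1)\<^sup>2 + (w $ 2 - z $ 2)\<^sup>2 + (w $ 3 - z $ 3)\<^sup>2 = 3"
    with int_squares_sum_le_three[of "w $ 1 - z $ 1" "w $ 2 - z $ 2" "w $ 3 - z $ 3"]
    show "w $ 1 - z $ 1 \<in> {-1, 1} \<and> w $ 2 - z $ 2 \<in> {-1, 1} \<and> w $ 3 - z $ 3 \<in> {-1, 1}"
      by auto
  qed auto
  finally show ?thesis .
qed

lemma fcc_adjacent:
  "adjacent fcc_lattice (half z) (half w)
    \<longleftrightarrow> (w $ 1 - z $ 1)\<^sup>2 + (w $ 2 - z $ 2)\<^sup>2 + (w $ 3 - z $ 3)\<^sup>2 = 2"
  by (simp add: fcc_lattice_def dist_half power_divide flip: of_int_eq_iff[where 'a = real])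

text \<open>For the body-centered lattice this is one class of the bipartition; for the face-centered lattice
  it splits every tetrahedron used below into two pairs.\<close>

definition even_layer :: "real ^ 3 \<Rightarrow> bool" where
  "even_layer x \<longleftrightarrow> x $ 1 \<in> \<int>"

lemma even_layer_half: "even_layer (half z) \<longleftrightarrow> even (z $ 1)"
proof
  assume "even_layer (half z)"
  then obtain k where "real_of_int (z $ 1) / 2 = of_int k"
    by (auto simp: even_layer_def half_def elim: Ints_cases)
  then have "real_of_int (z $ 1) = real_of_int (2 * k)" by simp
  then have "z $ 1 = 2 * k" by (simp only: of_int_eq_iff)
  then show "even (z $ 1)" by simp
qed (auto simp: even_layer_def half_def elim!: evenE)

lemma bcc_nbrs:
  assumes "half z \<in> vertices bcc_lattice"
  shows "nbrs bcc_lattice (half z) = (\<lambda>d. half (z + d)) ` {d. \<forall>i. d $ i \<in> {-1, 1}}"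
proof (intro equalityI subsetI)
  fix y assume y: "y \<in> nbrs bcc_lattice (half z)"
  then obtain w where w: "y = half w"
    by (auto simp: nbrs_def oriented_edges_def bcc_vertices)
  then have "\<forall>i. (w - z) $ i \<in> {-1, 1}"
    using y bcc_adjacent[of z w] by (simp add: nbrs_def oriented_edges_def)
  then show "y \<in> (\<lambda>d. half (z + d)) ` {d. \<forall>i. d $ i \<in> {-1, 1}}"
    using w by (intro image_eqI[of _ _ "w - z"]) auto
next
  fix y assume "y \<in> (\<lambda>d. half (z + d)) ` {d. \<forall>i. d $ i \<in> {-1, 1}}"
  then obtain d :: "int ^ 3" where d: "y = half (z + d)" "\<forall>i. d $ i \<in> {-1, 1}" by blast
  have "odd (d $ i)" for i using d(2)[THEN spec, of i] by auto
  then have "half (z + d) \<in> vertices bcc_lattice"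
    using assms by (auto simp: bcc_vertices half_eq_iff)
  moreover have "adjacent bcc_lattice (half z) (half (z + d))"
    using d(2) by (simp add: bcc_adjacent)
  ultimately show "y \<in> nbrs bcc_lattice (half z)"
    using assms d(1) by (simp add: nbrs_def oriented_edges_def)
qed

lemma bcc_regular: "regular_graph bcc_lattice 8"
  unfolding regular_graph_def
proof (intro conjI ballI)
  show "sym (oriented_edges bcc_lattice)"
    by (rule symI) (auto simp: oriented_edges_def bcc_lattice_def dist_commute)
  show "irrefl (oriented_edges bcc_lattice)"
    by (auto simp: irrefl_def oriented_edges_def bcc_lattice_def)
  fix x assume x: "x \<in> vertices bcc_lattice"
  then obtain z where z: "x = half z" by (auto simp: bcc_vertices)
  let ?D = "{d :: int ^ 3. \<forall>i. d $ i \<in> {-1, 1}}"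
  let ?P = "PiE (UNIV :: 3 set) (\<lambda>_. {-1, 1 :: int})"
  have D: "?D = vec_lambda ` ?P"
  proof (intro equalityI subsetI)
    fix d :: "int ^ 3" assume "d \<in> ?D"
    then have "(\<lambda>i. d $ i) \<in> ?P" by (auto simp: PiE_def)
    then show "d \<in> vec_lambda ` ?P" by (metis image_eqI vec_nth_inverse)
  qed (auto simp: PiE_def Pi_def)
  have "inj_on vec_lambda ?P" by (auto simp: inj_on_def vec_lambda_inject)
  then have card: "card ?D = 8" "finite ?D"
    unfolding D by (simp_all add: card_image card_PiE finite_PiE power3_eq_cube)
  have "inj_on (\<lambda>d. half (z + d)) ?D" by (auto simp: inj_on_def half_eq_iff)
  then show "card (nbrs bcc_lattice x) = 8" "finite (nbrs bcc_lattice x)"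
    using x card unfolding z by (simp_all only: bcc_nbrs card_image finite_imageI)
qed

lemma bcc_norm:
  "l2_bounded bcc_lattice (edge_laplacian bcc_lattice)"
  "l2_onorm bcc_lattice (edge_laplacian bcc_lattice) = 16"
proof -
  have edge: "\<exists>z w. x = half z \<and> y = half w \<and> (\<forall>i. w $ i - z $ i \<in> {-1, 1})"
    if "(x, y) \<in> oriented_edges bcc_lattice" for x y
  proof -
    from that obtain z w where "x = half z" "y = half w" "adjacent bcc_lattice x y"
      by (auto simp: oriented_edges_def bcc_vertices)
    then show ?thesis using bcc_adjacent by blast
  qed
  have exh: "poly_exhaustion bcc_lattice (\<lambda>n. \<Union>h\<in>{half}. h ` int_cube n)"
  proof (rule poly_exhaustion_cells)
    fix h x y assume "h \<in> {half}" "y \<in> nbrs bcc_lattice (h x)"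
    then obtain z w where zw: "half x = half z" "y = half w" "h = half" "\<forall>i. w $ i - z $ i \<in> {-1, 1}"
      using edge[of "half x" y] by (auto simp: nbrs_def)
    have "\<bar>w $ i - x $ i\<bar> \<le> 1" for i
    proof -
      have "w $ i - x $ i = -1 \<or> w $ i - x $ i = 1"
        using zw(1) zw(4)[THEN spec, of i] by (simp add: half_eq_iff)
      then show ?thesis by linarith
    qed
    then show "\<exists>h'\<in>{half}. \<exists>x'. y = h' x' \<and> (\<forall>i. \<bar>x' $ i - x $ i\<bar> \<le> 1)"
      using zw by blast
  qed (auto simp: bcc_vertices)
  have alt: "even_layer y \<longleftrightarrow> \<not> even_layer x" if "(x, y) \<in> oriented_edges bcc_lattice" for x y
  proof -
    from edge[OF that]
    obtain z w where zw: "x = half z" "y = half w" "\<forall>i. w $ i - z $ i \<in> {-1, 1}"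
      by blast
    have "w $ 1 - z $ 1 = -1 \<or> w $ 1 - z $ 1 = 1" using zw(3)[THEN spec, of 1] by simp
    then have "even (w $ 1) \<longleftrightarrow> odd (z $ 1)" by presburger
    then show ?thesis by (simp add: zw(1,2) even_layer_half)
  qed
  show "l2_bounded bcc_lattice (edge_laplacian bcc_lattice)"
    "l2_onorm bcc_lattice (edge_laplacian bcc_lattice) = 16"
    using bipartite_laplacian_norm[OF bcc_regular _ exh alt] by simp_all
qed

text \<open>The tetrahedra \<open>x, x + (0,1/2,1/2), x + (1/2,0,1/2), x + (1/2,1/2,0)\<close> of one orientation contain
  every edge exactly once, so \<open>k = m = 4\<close>. The first coordinate is an integer, up to a common shift
  by \<open>1/2\<close>, at exactly two vertices of each, so the signs given by \<open>even_layer\<close> cancel.\<close>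

lemma fcc_norm:
  "regular_graph fcc_lattice 12"
  "l2_bounded fcc_lattice (edge_laplacian fcc_lattice)"
  "l2_onorm fcc_lattice (edge_laplacian fcc_lattice) = 16"
proof -
  let ?G = fcc_lattice
  define T :: "(int ^ 3) set" where "T = {0, vector [0, 1, 1], vector [1, 0, 1], vector [1, 1, 0]}"
  let ?S = "half ` T"
  note coord = vec_eq_iff forall_3
  have cT: "card T = 4" by (simp add: T_def coord)
  then have cS: "card ?S = 4" using inj_half by (simp add: card_image inj_on_subset)
  have T_even: "even (t $ 1 + t $ 2 + t $ 3)" if "t \<in> T" for t
    using that by (auto simp: T_def)
  have sidonT: "s = s'" if "s \<in> T" "t \<in> T" "s' \<in> T" "t' \<in> T" "s \<noteq> t" "t - s = t' - s'" for s t s' t'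
  proof -
    have "t $ i - s $ i = t' $ i - s' $ i" for i using that(6) by (metis vector_minus_component)
    from this[of 1] this[of 2] this[of 3] that(1-5) show ?thesis
      unfolding T_def by (elim insertE emptyE; simp)
  qed
  have adjT: "adjacent ?G (half z) (half w) \<longleftrightarrow> (\<exists>s\<in>T. \<exists>t\<in>T. s \<noteq> t \<and> w - z = t - s)" for z w
  proof
    assume "\<exists>s\<in>T. \<exists>t\<in>T. s \<noteq> t \<and> w - z = t - s"
    then obtain s t where st: "s \<in> T" "t \<in> T" "s \<noteq> t" "w - z = t - s" by blast
    then have wz: "w $ i - z $ i = t $ i - s $ i" for i by (metis vector_minus_component)
    have "(t $ 1 - s $ 1)\<^sup>2 + (t $ 2 - s $ 2)\<^sup>2 + (t $ 3 - s $ 3)\<^sup>2 = 2"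
      using st(1-3) unfolding T_def by (elim insertE emptyE; simp)
    then show "adjacent ?G (half z) (half w)"
      unfolding fcc_adjacent wz .
  next
    assume "adjacent ?G (half z) (half w)"
    then have eq: "(w $ 1 - z $ 1)\<^sup>2 + (w $ 2 - z $ 2)\<^sup>2 + (w $ 3 - z $ 3)\<^sup>2 = 2"
      by (simp add: fcc_adjacent)
    define a b c where abc: "a = w $ 1 - z $ 1" "b = w $ 2 - z $ 2" "c = w $ 3 - z $ 3"
    have sq: "a\<^sup>2 + b\<^sup>2 + c\<^sup>2 = 2" using eq by (simp add: abc)
    then have range: "a \<in> {-1, 0, 1}" "b \<in> {-1, 0, 1}" "c \<in> {-1, 0, 1}"
      using int_squares_sum_le_three[of a b c] by simp_all
    have "\<exists>s\<in>T. \<exists>t\<in>T. t $ 1 - s $ 1 = a \<and> t $ 2 - s $ 2 = b \<and> t $ 3 - s $ 3 = c"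
      using range sq unfolding T_def by (elim insertE emptyE; simp)
    then obtain s t where st: "s \<in> T" "t \<in> T" "t $ 1 - s $ 1 = a" "t $ 2 - s $ 2 = b" "t $ 3 - s $ 3 = c"
      by blast
    moreover have "s \<noteq> t" using st(3-5) sq by auto
    moreover have "w - z = t - s" using st(3-5) by (simp add: coord abc)
    ultimately show "\<exists>s\<in>T. \<exists>t\<in>T. s \<noteq> t \<and> w - z = t - s" by blast
  qed
  have "clique_partition ?G ((\<lambda>x. (+) x ` ?S) ` vertices ?G) (card ?S) (card ?S)"
  proof (rule translate_clique_partition)
    fix x s assume "x \<in> vertices ?G" "s \<in> ?S"
    then obtain z t where z: "even (z $ 1 + z $ 2 + z $ 3)" and t: "t \<in> T" and x: "x = half z" "s = half t"
      by (auto simp: fcc_vertices)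
    have "x + s = half (z + t)" "x - s = half (z - t)" by (simp_all add: x half_add half_diff)
    moreover have "even ((z + t) $ 1 + (z + t) $ 2 + (z + t) $ 3)" "even ((z - t) $ 1 + (z - t) $ 2 + (z - t) $ 3)"
      using z T_even[OF t] by auto
    ultimately show "x + s \<in> vertices ?G \<and> x - s \<in> vertices ?G"
      unfolding fcc_vertices by blast
  next
    fix x y assume "x \<in> vertices ?G" "y \<in> vertices ?G"
    then obtain z w where zw: "x = half z" "y = half w" by (auto simp: fcc_vertices)
    show "adjacent ?G x y \<longleftrightarrow> (\<exists>s\<in>?S. \<exists>t\<in>?S. s \<noteq> t \<and> y - x = t - s)"
      by (simp add: zw adjT half_eq_iff flip: half_diff)
  next
    fix s t s' t' assume "s \<in> ?S" "t \<in> ?S" "s' \<in> ?S" "t' \<in> ?S" "s \<noteq> t" "t - s = t' - s'"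
    then obtain a b a' b' where T: "a \<in> T" "b \<in> T" "a' \<in> T" "b' \<in> T"
      and eqs: "s = half a" "t = half b" "s' = half a'" "t' = half b'" and ne: "s \<noteq> t" and d: "t - s = t' - s'"
      by blast
    have "b - a = b' - a'"
      using d unfolding eqs half_diff[symmetric] half_eq_iff .
    moreover have "a \<noteq> b" using ne eqs by blast
    ultimately show "s = s'" using sidonT[OF T] eqs by simp
  qed (simp add: T_def)
  then interpret clique_partition ?G "(\<lambda>x. (+) x ` ?S) ` vertices ?G" 4 4
    unfolding cS .
  have exh: "poly_exhaustion ?G (\<lambda>n. \<Union>h\<in>{half}. h ` int_cube n)"
  proof (rule poly_exhaustion_cells)
    fix h x y assume h: "h \<in> {half}" "y \<in> nbrs ?G (h x)"
    then obtain w where w: "y = half w" "adjacent ?G (half x) (half w)"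
      by (auto simp: nbrs_def oriented_edges_def fcc_vertices)
    have "\<forall>i. \<bar>w $ i - x $ i\<bar> \<le> 1"
      using w(2) int_squares_sum_le_three[of "w $ 1 - x $ 1" "w $ 2 - x $ 2" "w $ 3 - x $ 3"]
      unfolding fcc_adjacent forall_3 by auto
    then show "\<exists>h'\<in>{half}. \<exists>x'. y = h' x' \<and> (\<forall>i. \<bar>x' $ i - x $ i\<bar> \<le> 1)"
      using w by blast
  qed (auto simp: fcc_vertices)
  define u :: "real ^ 3 \<Rightarrow> complex" where "u x = (if even_layer x then 1 else -1)" for x
  have unit: "cmod (u x) = 1" for x by (simp add: u_def)
  have balanced: "(\<Sum>x\<in>c. u x) = 0" if c: "c \<in> (\<lambda>x. (+) x ` ?S) ` vertices ?G" for c
  proof -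
    obtain z where c: "c = (+) (half z) ` ?S" using c by (auto simp: fcc_vertices)
    have "(\<Sum>x\<in>c. u x) = (\<Sum>t\<in>T. u (half (z + t)))"
      unfolding c image_image half_add[symmetric]
      by (subst sum.reindex) (auto simp: inj_on_def half_eq_iff)
    also have "\<dots> = (\<Sum>t\<in>T. if even (z $ 1 + t $ 1) then 1 else -1)"
      by (simp only: u_def even_layer_half vector_add_component)
    also have "\<dots> = 0"
      unfolding T_def by (subst sum.insert; simp add: coord)+
    finally show ?thesis .
  qed
  show "regular_graph ?G 12" "l2_bounded ?G (edge_laplacian ?G)" "l2_onorm ?G (edge_laplacian ?G) = 16"
    using laplacian_norm[OF exh unit balanced] by simp_all
qed

section \<open>The norms for the eight lattices\<close>

theorem mainTheorem8:
  "(regular_graph (integer_lattice :: (int ^ 2) graph) 4 \<and>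
      l2_bounded (integer_lattice :: (int ^ 2) graph) (edge_laplacian (integer_lattice :: (int ^ 2) graph)) \<and>
      l2_onorm (integer_lattice :: (int ^ 2) graph) (edge_laplacian (integer_lattice :: (int ^ 2) graph)) = 8 \<and> (8::real) = 2 * 4) \<and>
     (regular_graph triangular_lattice 6 \<and>
      l2_bounded triangular_lattice (edge_laplacian triangular_lattice) \<and>
      l2_onorm triangular_lattice (edge_laplacian triangular_lattice) = 9 \<and> (9::real) < 12 \<and> (12::real) = 2 * 6) \<and>
     (regular_graph (integer_lattice :: (int ^ 3) graph) 6 \<and>
      l2_bounded (integer_lattice :: (int ^ 3) graph) (edge_laplacian (integer_lattice :: (int ^ 3) graph)) \<and>
      l2_onorm (integer_lattice :: (int ^ 3) graph) (edge_laplacian (integer_lattice :: (int ^ 3) graph)) = 12 \<and> (12::real) = 2 * 6) \<and>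
     (regular_graph bcc_lattice 8 \<and>
      l2_bounded bcc_lattice (edge_laplacian bcc_lattice) \<and>
      l2_onorm bcc_lattice (edge_laplacian bcc_lattice) = 16 \<and> (16::real) = 2 * 8) \<and>
     (regular_graph fcc_lattice 12 \<and>
      l2_bounded fcc_lattice (edge_laplacian fcc_lattice) \<and>
      l2_onorm fcc_lattice (edge_laplacian fcc_lattice) = 16 \<and> (16::real) < 24 \<and> (24::real) = 2 * 12) \<and>
     (regular_graph kagome_lattice 4 \<and>
      l2_bounded kagome_lattice (edge_laplacian kagome_lattice) \<and>
      l2_onorm kagome_lattice (edge_laplacian kagome_lattice) = 6 \<and> (6::real) < 8 \<and> (8::real) = 2 * 4) \<and>
     (regular_graph diamond_lattice 4 \<and>
      l2_bounded diamond_lattice (edge_laplacian diamond_lattice) \<and>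
      l2_onorm diamond_lattice (edge_laplacian diamond_lattice) = 8 \<and> (8::real) = 2 * 4) \<and>
     (regular_graph (integer_lattice :: (int ^ 4) graph) 8 \<and>
      l2_bounded (integer_lattice :: (int ^ 4) graph) (edge_laplacian (integer_lattice :: (int ^ 4) graph)) \<and>
      l2_onorm (integer_lattice :: (int ^ 4) graph) (edge_laplacian (integer_lattice :: (int ^ 4) graph)) = 16 \<and> (16::real) = 2 * 8)"
  using integer_lattice_regular[where 'n = 2] integer_lattice_norm[where 'n = 2]
    integer_lattice_regular[where 'n = 3] integer_lattice_norm[where 'n = 3]
    integer_lattice_regular[where 'n = 4] integer_lattice_norm[where 'n = 4]
    triangular_norm bcc_regular bcc_norm fcc_norm kagome_norm diamond_regular diamond_norm
  by simp

end
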